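(* Let $\mathcal{T}$ be a non-periodic, repetitive tiling of $\mathbb{R}^d$ (with finite local complexity). Then $\mathcal{T}$ is pseudo-self-similar if and only if its derived Voronoi family $\mathcal{F}(\mathcal{T})$ is $\psi$-finite for some expanding, orientation-preserving similitude $\psi$ of $\mathbb{R}^d$.
   Context: Tilings. Fix a finite set of types (labels) $\{1,\dots,m\}$. A tile in $\mathbb{R}^d$ is a pair $T=(A,i)$, where $A=\mathrm{supp}(T)$ is a compact set which is the closure of its interior and $i=\ell(T)$ is its type. A tiling of $\mathbb{R}^d$ is a set $\mathcal{T}$ of tiles whose supports cover $\mathbb{R}^d$ and such that distinct tiles have disjoint interiors. A $\mathcal{T}$-patch is a finite subset $P\subset\mathcal{T}$; $\mathrm{supp}(P)=\bigcup_{T\in P}\mathrm{supp}(T)$. Translates: $(A,i)+g=(A+g,i)$, $P+g=\{T+g:T\in P\}$. Patches (or tiles) are translationally equivalent if one is a translate of the other. For an invertible linear map $\psi$, $\psi\mathcal{T}=\{(\psi(\mathrm{supp}(T)),\ell(T)): T\in\mathcal{T}\}$. It is always assumed that any two tiles of a tiling with the same type are translationally equivalent, and that tilings have finite local complexity (FLC): for any $R>0$ there are finitely many patches whose supports have diameter less than $R$ up to translation equivalence. (Label sets may be arbitrary finite sets.) A tiling is non-periodic if $\mathcal{T}+g=\mathcal{T}$ only for $g=0$. Here $|\cdot|$ is the Euclidean norm, and $N_R(x)=B_R(x)$ is the closed ball of radius $R$ centered at $x$. For $F\subset\mathbb{R}^d$ put $[F]^{\mathcal{T}}=\{T\in\mathcal{T}:\mathrm{supp}(T)\cap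 F\ne\emptyset\}$ and $[x]^{\mathcal{T}}=[\{x\}]^{\mathcal{T}}$. A tiling $\mathcal{T}$ is repetitive if for any patch $P\subset\mathcal{T}$ there is $R>0$ such that for any $x\in\mathbb{R}^d$ there is a $\mathcal{T}$-patch $P'$ which is a translate of $P$ with $\mathrm{supp}(P')\subset N_R(x)$; the minimal such $R$ is the repetitivity radius of $P$. A tiling $\mathcal{T}_2$ is locally derivable (LD) from $\mathcal{T}_1$ if there is $R>0$ such that for all $x,y\in\mathbb{R}^d$: $[N_R(x)]^{\mathcal{T}_1}=[N_R(y)]^{\mathcal{T}_1}+(x-y)$ implies $[x]^{\mathcal{T}_2}=[y]^{\mathcal{T}_2}+(x-y)$. An expanding similitude is a linear map $\phi:\mathbb{R}^d\to\mathbb{R}^d$ with $|\phi(x)-\phi(y)|=\lambda|x-y|$ for all $x,y$, for some $\lambda>1$. A repetitive FLC tiling $\mathcal{T}$ is pseudo-self-similar if there is an expanding similitude $\phi$ such that $\mathcal{T}$ is LD from $\phi\mathcal{T}$. Derived Voronoi family. Let $\mathcal{T}$ be a repetitive tiling. For $r>0$ let $P_r=[B_r(0)]^{\mathcal{T}}$ and let the locator set be $\mathcal{L}_r=\{q\in\mathbb{R}^d:\ \text{there exists } P\subset\mathcal{T}\text{ with }P_r=P-q\}$. Let $R(r)$ be the repetitivity radius of $P_r$. The derived Voronoi tiling $\mathcal{T}_r$ has one tile $t_q$ for each $q\in\mathcal{L}_r$, with support $\mathrm{supp}(t_q)=\{x\in\mathbb{R}^d: |q-x|\le|q'-x|\text{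 for all }q'\in\mathcal{L}_r\}$, and $t_q$ is labeled by the translational equivalence class of the patch $[B_{2R(r)}(q)]^{\mathcal{T}}$. The derived Voronoi family is $\mathcal{F}(\mathcal{T})=\{\mathcal{T}_r: r>0\}$. Given an expanding similitude $\psi$, a family $\mathcal{F}$ of tilings is $\psi$-finite if there exist finitely many $\mathcal{S}_1,\dots,\mathcal{S}_M\in\mathcal{F}$ such that for any tiling $\mathcal{S}\in\mathcal{F}$ there are $i\in\{1,\dots,M\}$ and an integer $j\ge 0$ with $\mathcal{S}=\psi^j\mathcal{S}_i$, where two tilings are identified if they are equal up to a one-to-one correspondence between their label sets. *)

theory Defs
  imports "HOL-Analysis.Analysis"
begin

type_synonym ('n, 'l) tile = "(real ^ 'n) set \<times> 'l"

abbreviation supp :: "('n::finite, 'l) tile \<Rightarrow> (real ^ 'n) set" where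
  "supp t \<equiv> fst t"

abbreviation label :: "('n::finite, 'l) tile \<Rightarrow> 'l" where
  "label t \<equiv> snd t"

definition is_tile :: "('n::finite, 'l) tile \<Rightarrow> bool" where
  "is_tile t \<longleftrightarrow> compact (supp t) \<and> supp t = closure (interior (supp t))"

definition tile_transl :: "real ^ 'n \<Rightarrow> ('n::finite, 'l) tile \<Rightarrow> ('n, 'l) tile" where
  "tile_transl g t = ((\<lambda>x. x + g) ` supp t, label t)"

text \<open>Translation of sets of tiles, used both for patches and for whole tilings.\<close>

definition transl :: "real ^ 'n \<Rightarrow> ('n::finite, 'l) tile set \<Rightarrow> ('n, 'l) tile set" where
  "transl g P = tile_transl g ` P"

definition transl_class :: "('n::finite, 'l) tile set \<Rightarrow> ('n, 'l) tile set set" where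
  "transl_class P = range (\<lambda>g. transl g P)"

text \<open>The type of labels is arbitrary; only finitely many labels may be used by a tiling.  The
  standing assumption that tiles with the same label are translates of each other is included.\<close>

definition is_tiling :: "('n::finite, 'l) tile set \<Rightarrow> bool" where
  "is_tiling T \<longleftrightarrow>
     (\<forall>t\<in>T. is_tile t) \<and>
     (\<Union>t\<in>T. supp t) = UNIV \<and>
     (\<forall>s\<in>T. \<forall>t\<in>T. s \<noteq> t \<longrightarrow> interior (supp s) \<inter> interior (supp t) = {}) \<and>
     finite (label ` T) \<and>
     (\<forall>s\<in>T. \<forall>t\<in>T. label s = label t \<longrightarrow> (\<exists>g. t = tile_transl g s))"

definition is_patch :: "('n::finite, 'l) tile set \<Rightarrow> ('n, 'l) tile set \<Rightarrow> bool" where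
  "is_patch T P \<longleftrightarrow> finite P \<and> P \<subseteq> T"

definition patch_supp :: "('n::finite, 'l) tile set \<Rightarrow> (real ^ 'n) set" where
  "patch_supp P = (\<Union>t\<in>P. supp t)"

definition FLC :: "('n::finite, 'l) tile set \<Rightarrow> bool" where
  "FLC T \<longleftrightarrow>
     (\<forall>R>0. finite (transl_class ` {P. is_patch T P \<and> diameter (patch_supp P) < R}))"

definition nonperiodic :: "('n::finite, 'l) tile set \<Rightarrow> bool" where
  "nonperiodic T \<longleftrightarrow> (\<forall>g. transl g T = T \<longrightarrow> g = 0)"

text \<open>The set of tiles that meet \<open>F\<close>, written $[F]^T$ in the literature.\<close>

definition meeting :: "('n::finite, 'l) tile set \<Rightarrow> (real ^ 'n) set \<Rightarrow> ('n, 'l) tile set" where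
  "meeting T F = {t\<in>T. supp t \<inter> F \<noteq> {}}"

definition recurs_within ::
    "('n::finite, 'l) tile set \<Rightarrow> ('n, 'l) tile set \<Rightarrow> real \<Rightarrow> bool" where
  "recurs_within T P R \<longleftrightarrow> R > 0 \<and>
     (\<forall>x. \<exists>P'. is_patch T P' \<and> (\<exists>g. P' = transl g P) \<and> patch_supp P' \<subseteq> cball x R)"

definition repetitive :: "('n::finite, 'l) tile set \<Rightarrow> bool" where
  "repetitive T \<longleftrightarrow> (\<forall>P. is_patch T P \<longrightarrow> (\<exists>R. recurs_within T P R))"

text \<open>For a nonempty patch of a repetitive tiling with finite local complexity, the minimum exists,
  since only finitely many translates of the patch lie in a bounded region.\<close>

definition rep_radius :: "('n::finite, 'l) tile set \<Rightarrow> ('n, 'l) tile set \<Rightarrow> real" where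
  "rep_radius T P = (LEAST R. recurs_within T P R)"

text \<open>\<open>locally_derivable T2 T1\<close>: \<open>T2\<close> is locally derivable from \<open>T1\<close>.\<close>

definition locally_derivable ::
    "('n::finite, 'k) tile set \<Rightarrow> ('n, 'l) tile set \<Rightarrow> bool" where
  "locally_derivable T2 T1 \<longleftrightarrow>
     (\<exists>R>0. \<forall>x y. meeting T1 (cball x R) = transl (x - y) (meeting T1 (cball y R)) \<longrightarrow>
                  meeting T2 {x} = transl (x - y) (meeting T2 {y}))"

definition map_tiling ::
    "(real ^ 'n \<Rightarrow> real ^ 'n) \<Rightarrow> ('n::finite, 'l) tile set \<Rightarrow> ('n, 'l) tile set" where
  "map_tiling f T = (\<lambda>t. (f ` supp t, label t)) ` T"

definition expanding_similitude :: "(real ^ 'n \<Rightarrow> real ^ 'n::finite) \<Rightarrow> bool" where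
  "expanding_similitude f \<longleftrightarrow>
     linear f \<and> (\<exists>c>1. \<forall>x y. norm (f x - f y) = c * norm (x - y))"

definition orientation_preserving :: "(real ^ 'n \<Rightarrow> real ^ 'n::finite) \<Rightarrow> bool" where
  "orientation_preserving f \<longleftrightarrow> det (matrix f) > 0"

definition pseudo_self_similar :: "('n::finite, 'l) tile set \<Rightarrow> bool" where
  "pseudo_self_similar T \<longleftrightarrow> is_tiling T \<and> FLC T \<and> repetitive T \<and>
     (\<exists>f. expanding_similitude f \<and> locally_derivable T (map_tiling f T))"

definition central_patch :: "('n::finite, 'l) tile set \<Rightarrow> real \<Rightarrow> ('n, 'l) tile set" where
  "central_patch T r = meeting T (cball 0 r)"

definition locators :: "('n::finite, 'l) tile set \<Rightarrow> real \<Rightarrow> (real ^ 'n) set" where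
  "locators T r = {q. \<exists>P. P \<subseteq> T \<and> central_patch T r = transl (- q) P}"

definition voronoi_cell :: "(real ^ 'n::finite) set \<Rightarrow> real ^ 'n \<Rightarrow> (real ^ 'n) set" where
  "voronoi_cell L q = {x. \<forall>q'\<in>L. norm (q - x) \<le> norm (q' - x)}"

text \<open>The labels of the derived tilings are translational equivalence classes of patches of the
  original tiling, each represented as the set of all translates of a patch.\<close>

definition derived_voronoi ::
    "('n::finite, 'l) tile set \<Rightarrow> real \<Rightarrow> ('n, ('n, 'l) tile set set) tile set" where
  "derived_voronoi T r =
     (\<lambda>q. (voronoi_cell (locators T r) q,
           transl_class (meeting T (cball q (2 * rep_radius T (central_patch T r))))))
     ` locators T r"

definition derived_voronoi_family ::
    "('n::finite, 'l) tile set \<Rightarrow> ('n, ('n, 'l) tile set set) tile set set" where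
  "derived_voronoi_family T = {derived_voronoi T r | r. r > 0}"

definition equal_up_to_labels ::
    "('n::finite, 'k) tile set \<Rightarrow> ('n, 'l) tile set \<Rightarrow> bool" where
  "equal_up_to_labels S S' \<longleftrightarrow>
     (\<exists>b. bij_betw b (label ` S) (label ` S') \<and> S' = (\<lambda>t. (supp t, b (label t))) ` S)"

definition finite_under ::
    "(real ^ 'n \<Rightarrow> real ^ 'n) \<Rightarrow> ('n::finite, 'k) tile set set \<Rightarrow> bool" where
  "finite_under f F \<longleftrightarrow>
     (\<exists>G. finite G \<and> G \<subseteq> F \<and>
        (\<forall>S\<in>F. \<exists>S'\<in>G. \<exists>j::nat. equal_up_to_labels S (map_tiling (f ^^ j) S')))"

end

theory Submission
  imports Defs
begin

text \<open>
  Write \<open>x \<sim>\<^sub>r y\<close> if the tiles meeting the ball of radius \<open>r\<close> at \<open>x\<close> are the translates by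
  \<open>x - y\<close> of those meeting the ball at \<open>y\<close>.

  Suppose that \<open>T\<close> is locally derivable from \<open>f T\<close>; replacing \<open>f\<close> by its square makes it preserve
  orientation.  Then \<open>x \<sim>\<^sub>r y\<close> implies \<open>f x \<sim> f y\<close> at radius \<open>c r - \<rho>\<close>, where \<open>c\<close> is the expansion
  factor.  Hence \<open>T\<close> is linearly repetitive, and by nonperiodicity a patch of radius \<open>r\<close> recurs
  only at distances of order \<open>r\<close>.  This gives unique composition: conversely, agreement at
  \<open>f x\<close>, \<open>f y\<close> yields agreement at \<open>x\<close>, \<open>y\<close> at the scaled-down radius, up to a constant.  So the locator
  set of radius \<open>s\<close>, pulled back to bounded scale by a power of \<open>f\<close>, is a union of classes of
  \<open>\<sim>\<^sub>M\<close> for a constant \<open>M\<close>, taken from a finite list, and so is its partition by labels.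

  For the converse, the pigeonhole principle provides two derived tilings of large radius which
  are related by some \<open>\<psi>\<^sup>k\<close>, \<open>k > 0\<close>.  Each is locally derivable from \<open>T\<close> and, once the
  locators are far apart, \<open>T\<close> is locally derivable from each.  Composing, \<open>T\<close> is locally derivable
  from \<open>\<psi>\<^sup>k T\<close>.
\<close>

subsection \<open>Agreement of a tiling around two points\<close>

text \<open>The hypothesis of local derivability, read as an equivalence relation on points for each
  fixed \<open>r\<close>. For negative \<open>r\<close> the balls are empty and the relation holds
  trivially, so radii such as \<open>c * r - \<rho>\<close> need no sign condition.\<close>

definition agree ::
    "('n::finite, 'l) tile set \<Rightarrow> real ^ 'n \<Rightarrow> real ^ 'n \<Rightarrow> real \<Rightarrow> bool" where
  "agree S x y r \<longleftrightarrow> meeting S (cball x r) = transl (x - y) (meeting S (cball y r))"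

lemma tile_transl_add: "tile_transl g (tile_transl h t) = tile_transl (h + g) t"
  by (auto simp: tile_transl_def image_image algebra_simps)

lemma tile_transl_0 [simp]: "tile_transl 0 t = t"
  by (simp add: tile_transl_def)

lemma inj_tile_transl: "inj (tile_transl g)"
proof (rule injI)
  fix s t :: "('a, 'b) tile"
  assume "tile_transl g s = tile_transl g t"
  then have "tile_transl (- g) (tile_transl g s) = tile_transl (- g) (tile_transl g t)" by simp
  then show "s = t" by (simp add: tile_transl_add)
qed

lemma transl_add: "transl g (transl h P) = transl (h + g) P"
  by (simp add: transl_def image_image tile_transl_add)

lemma transl_0 [simp]: "transl 0 P = P"
  by (simp add: transl_def)

lemma in_transl_iff: "t \<in> transl g P \<longleftrightarrow> tile_transl (- g) t \<in> P"
proof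
  assume "t \<in> transl g P"
  then show "tile_transl (- g) t \<in> P" by (auto simp: transl_def tile_transl_add)
next
  assume "tile_transl (- g) t \<in> P"
  then have "tile_transl g (tile_transl (- g) t) \<in> transl g P" unfolding transl_def by blast
  then show "t \<in> transl g P" by (simp add: tile_transl_add)
qed

lemma supp_tile_transl: "supp (tile_transl g t) = (\<lambda>x. x + g) ` supp t"
  by (simp add: tile_transl_def)

lemma mem_supp_tile_transl: "p \<in> supp (tile_transl g t) \<longleftrightarrow> p - g \<in> supp t"
  by (force simp: supp_tile_transl image_iff)

lemma patch_supp_transl: "patch_supp (transl g P) = (\<lambda>x. x + g) ` patch_supp P"
  by (auto simp: patch_supp_def transl_def supp_tile_transl)

lemma mem_meeting_cball:
  "t \<in> meeting S (cball x r) \<longleftrightarrow> t \<in> S \<and> (\<exists>p\<in>supp t. dist x p \<le> r)"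
  by (auto simp: meeting_def)

lemma meeting_cball_mono:
  assumes "dist x y + r' \<le> r"
  shows "meeting S (cball y r') \<subseteq> meeting S (cball x r)"
proof
  fix t assume "t \<in> meeting S (cball y r')"
  then obtain p where "t \<in> S" "p \<in> supp t" "dist y p \<le> r'" by (auto simp: mem_meeting_cball)
  moreover have "dist x p \<le> dist x y + dist y p" by (rule dist_triangle)
  ultimately show "t \<in> meeting S (cball x r)" using assms by (force simp: mem_meeting_cball)
qed

lemma tile_transl_in_meeting_cball:
  assumes "t \<in> meeting S (cball y r)" "tile_transl g t \<in> S"
  shows "tile_transl g t \<in> meeting S (cball (y + g) r)"
proof -
  obtain p where p: "p \<in> supp t" "dist y p \<le> r" using assms(1) by (auto simp: mem_meeting_cball)
  then have "p + g \<in> supp (tile_transl g t)" "dist (y + g) (p + g) \<le> r"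
    by (simp_all add: mem_supp_tile_transl dist_norm)
  then show ?thesis using assms(2) unfolding mem_meeting_cball by blast
qed

text \<open>A translated tile meets the translated ball automatically, so only membership in
  \<open>S\<close> remains to be checked, once in each direction.\<close>

lemma agree_iff:
  "agree S x y r \<longleftrightarrow>
     (\<forall>t\<in>meeting S (cball y r). tile_transl (x - y) t \<in> S) \<and>
     (\<forall>t\<in>meeting S (cball x r). tile_transl (y - x) t \<in> S)"
proof
  assume a: "agree S x y r"
  show "(\<forall>t\<in>meeting S (cball y r). tile_transl (x - y) t \<in> S) \<and>
     (\<forall>t\<in>meeting S (cball x r). tile_transl (y - x) t \<in> S)"
  proof (intro conjI ballI)
    fix t assume "t \<in> meeting S (cball y r)"
    then have "tile_transl (x - y) t \<in> meeting S (cball x r)"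
      using a by (auto simp: agree_def transl_def)
    then show "tile_transl (x - y) t \<in> S" by (simp add: meeting_def)
  next
    fix t assume "t \<in> meeting S (cball x r)"
    then have "tile_transl (- (x - y)) t \<in> meeting S (cball y r)"
      using a by (simp add: agree_def in_transl_iff)
    then show "tile_transl (y - x) t \<in> S" by (simp add: meeting_def)
  qed
next
  assume a: "(\<forall>t\<in>meeting S (cball y r). tile_transl (x - y) t \<in> S) \<and>
     (\<forall>t\<in>meeting S (cball x r). tile_transl (y - x) t \<in> S)"
  show "agree S x y r"
    unfolding agree_def
  proof (intro set_eqI iffI)
    fix t assume t: "t \<in> meeting S (cball x r)"
    with a tile_transl_in_meeting_cball[OF t, of "y - x"]
    show "t \<in> transl (x - y) (meeting S (cball y r))" by (simp add: in_transl_iff)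
  next
    fix t assume "t \<in> transl (x - y) (meeting S (cball y r))"
    then obtain u where "u \<in> meeting S (cball y r)" "t = tile_transl (x - y) u"
      by (auto simp: transl_def)
    with a tile_transl_in_meeting_cball[of u S y r "x - y"]
    show "t \<in> meeting S (cball x r)" by simp
  qed
qed

lemma agree_refl [simp]: "agree S x x r"
  by (simp add: agree_def)

lemma agree_sym: "agree S x y r \<Longrightarrow> agree S y x r"
  by (auto simp: agree_iff)

lemma agree_trans:
  assumes "agree S x y r" "agree S y z r"
  shows "agree S x z r"
  using assms by (simp add: agree_def transl_add)

lemma agree_shift:
  assumes "agree S x y r" "norm w + r' \<le> r"
  shows "agree S (x + w) (y + w) r'"
proof -
  have "meeting S (cball (x + w) r') \<subseteq> meeting S (cball x r)"
    "meeting S (cball (y + w) r') \<subseteq> meeting S (cball y r)"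
    using assms(2) by (auto intro!: meeting_cball_mono simp: dist_norm del: subsetI)
  then show ?thesis using assms(1) unfolding agree_iff by auto
qed

lemma agree_mono: "agree S x y r \<Longrightarrow> r' \<le> r \<Longrightarrow> agree S x y r'"
  using agree_shift[of S x y r 0 r'] by simp

lemma agree_shift':
  assumes "agree S x y r" "norm (x' - x) + r' \<le> r" "x' - x = y' - y"
  shows "agree S x' y' r'"
proof -
  have "x + (x' - x) = x'" by simp
  moreover have "y + (x' - x) = y'" using assms(3) by simp
  ultimately show ?thesis using agree_shift[OF assms(1,2)] by simp
qed

text \<open>A tile meeting the ball contains some point \<open>y + w\<close> of it and is already
  seen by the agreement of radius 0 there. Pointwise conclusions, as local derivability provides
  them, thereby extend to balls.\<close>

lemma agree_local:
  assumes "\<And>w. norm w \<le> r \<Longrightarrow> agree S (x + w) (y + w) 0"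
  shows "agree S x y r"
proof -
  have 1: "tile_transl (x - y) t \<in> S"
    if *: "\<And>w. norm w \<le> r \<Longrightarrow> agree S (x + w) (y + w) 0" and t: "t \<in> meeting S (cball y r)" for x y t
  proof -
    obtain p where p: "t \<in> S" "p \<in> supp t" "dist y p \<le> r"
      using t by (auto simp: mem_meeting_cball)
    have "agree S (x + (p - y)) (y + (p - y)) 0"
      by (rule *) (use p in \<open>simp add: dist_norm norm_minus_commute\<close>)
    moreover have "t \<in> meeting S (cball (y + (p - y)) 0)" using p by (auto simp: meeting_def)
    ultimately have "tile_transl ((x + (p - y)) - (y + (p - y))) t \<in> S"
      unfolding agree_iff by blast
    then show ?thesis by simp
  qed
  show ?thesis unfolding agree_iff
    using 1[OF assms] 1[of y x] assms agree_sym by blast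
qed

lemma locally_derivable_agree:
  "locally_derivable T2 T1 \<longleftrightarrow> (\<exists>R>0. \<forall>x y. agree T1 x y R \<longrightarrow> agree T2 x y 0)"
  by (simp add: locally_derivable_def agree_def)

lemma agree_of_local_rule:
  assumes "\<And>x y. agree T1 x y R \<Longrightarrow> agree T2 x y 0" "agree T1 x y (R + s)"
  shows "agree T2 x y s"
proof (rule agree_local)
  fix w :: "real ^ 'a" assume "norm w \<le> s"
  then show "agree T2 (x + w) (y + w) 0"
    by (intro assms(1) agree_shift[OF assms(2)]) simp
qed

subsection \<open>Similitudes and relabellings\<close>

lemma funpow_similitude:
  fixes f :: "real ^ 'n::finite \<Rightarrow> real ^ 'n"
  assumes "linear f" "\<And>x y. norm (f x - f y) = c * norm (x - y)"
  shows "linear (f ^^ n)" "norm ((f ^^ n) x - (f ^^ n) y) = c ^ n * norm (x - y)"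
proof -
  show "linear (f ^^ n)"
    by (induction n) (use assms(1) linear_compose in \<open>auto simp: linear_ident id_def o_def\<close>)
  show "norm ((f ^^ n) x - (f ^^ n) y) = c ^ n * norm (x - y)"
    by (induction n) (simp_all add: assms(2) mult_ac)
qed

lemma similitude_inj:
  fixes f :: "real ^ 'n::finite \<Rightarrow> real ^ 'n"
  assumes "\<And>x y. norm (f x - f y) = c * norm (x - y)" "c > 0"
  shows "inj f"
proof (rule injI)
  fix x y assume "f x = f y"
  then have "c * norm (x - y) = 0" using assms(1)[of x y] by simp
  then show "x = y" using assms(2) by simp
qed

lemma similitude_surj:
  fixes f :: "real ^ 'n::finite \<Rightarrow> real ^ 'n"
  assumes "linear f" "\<And>x y. norm (f x - f y) = c * norm (x - y)" "c > 0"
  shows "surj f"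
  using assms(1) similitude_inj[of f c] assms(2,3) linear_inj_imp_surj by blast

lemma map_tiling_transl_tile:
  assumes "linear f"
  shows "(f ` supp (tile_transl g t), label (tile_transl g t)) = tile_transl (f g) (f ` supp t, label t)"
  by (auto simp: tile_transl_def image_image linear_add[OF assms])

lemma agree_map_tiling:
  fixes f :: "real ^ 'n::finite \<Rightarrow> real ^ 'n" and S :: "('n, 'l) tile set"
  assumes f: "linear f" "\<And>x y. norm (f x - f y) = c * norm (x - y)" "c > 0"
  shows "agree (map_tiling f S) (f x) (f y) (c * r) \<longleftrightarrow> agree S x y r"
proof -
  define F where "F t = (f ` supp t, label t)" for t :: "('n, 'l) tile"
  have inj: "inj F"
  proof (rule injI)
    fix s t assume "F s = F t"
    then show "s = t"
      using inj_image_eq_iff[OF similitude_inj[of f c, OF f(2,3)]] by (simp add: F_def prod_eq_iff)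
  qed
  have M: "map_tiling f S = F ` S" by (simp add: map_tiling_def F_def)
  have F: "F (tile_transl g t) = tile_transl (f g) (F t)" for g t
    using map_tiling_transl_tile[OF f(1)] by (simp add: F_def)
  have meet: "F t \<in> meeting (F ` S) (cball (f z) (c * r)) \<longleftrightarrow> t \<in> meeting S (cball z r)" for t z
  proof -
    have "(\<exists>p\<in>supp (F t). dist (f z) p \<le> c * r) \<longleftrightarrow> (\<exists>p\<in>supp t. dist z p \<le> r)"
      using f(3) by (auto simp: F_def dist_norm f(2))
    then show ?thesis by (simp add: mem_meeting_cball inj_image_mem_iff[OF inj])
  qed
  have half: "(\<forall>t\<in>meeting (F ` S) (cball (f y) (c * r)). tile_transl (f x - f y) t \<in> F ` S) \<longleftrightarrow>
     (\<forall>t\<in>meeting S (cball y r). tile_transl (x - y) t \<in> S)" for x y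
  proof -
    have "meeting (F ` S) (cball (f y) (c * r)) = F ` meeting S (cball y r)"
    proof (intro set_eqI iffI)
      fix u assume u: "u \<in> meeting (F ` S) (cball (f y) (c * r))"
      then obtain t where "u = F t" by (auto simp: meeting_def)
      with u meet show "u \<in> F ` meeting S (cball y r)" by blast
    qed (use meet in blast)
    then show ?thesis
      by (auto simp: F[symmetric] linear_diff[OF f(1), symmetric] inj_image_mem_iff[OF inj])
  qed
  show ?thesis unfolding agree_iff M half ..
qed

lemma equal_up_to_labels_refl [simp]: "equal_up_to_labels S S"
  unfolding equal_up_to_labels_def by (rule exI[of _ id]) auto

lemma equal_up_to_labels_sym:
  assumes "equal_up_to_labels S S'"
  shows "equal_up_to_labels S' S"
proof -
  obtain b where b: "bij_betw b (label ` S) (label ` S')" "S' = (\<lambda>t. (supp t, b (label t))) ` S"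
    using assms by (auto simp: equal_up_to_labels_def)
  define b' where "b' = the_inv_into (label ` S) b"
  have "b' (b (label t)) = label t" if "t \<in> S" for t
    unfolding b'_def using b(1) that by (auto simp: bij_betw_def intro: the_inv_into_f_f)
  then have "S = (\<lambda>t. (supp t, b' (label t))) ` S'"
    unfolding b(2) image_image by (simp add: image_def)
  moreover have "bij_betw b' (label ` S') (label ` S)"
    unfolding b'_def using b(1) by (rule bij_betw_the_inv_into)
  ultimately show ?thesis unfolding equal_up_to_labels_def by blast
qed

lemma agree_relabel:
  assumes "equal_up_to_labels S S'" "agree S x y r"
  shows "agree S' x y r"
proof -
  obtain b where b: "S' = (\<lambda>t. (supp t, b (label t))) ` S"
    using assms(1) by (auto simp: equal_up_to_labels_def)
  have *: "tile_transl (x - y) u \<in> S'"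
    if S: "\<forall>t\<in>meeting S (cball y r). tile_transl (x - y) t \<in> S" and u: "u \<in> meeting S' (cball y r)" for x y u
  proof -
    obtain t where t: "t \<in> S" "u = (supp t, b (label t))" using u by (auto simp: meeting_def b)
    then have "t \<in> meeting S (cball y r)" using u by (simp add: mem_meeting_cball)
    then have "tile_transl (x - y) t \<in> S" using S by blast
    moreover have "tile_transl (x - y) u =
        (supp (tile_transl (x - y) t), b (label (tile_transl (x - y) t)))"
      by (simp add: t(2) tile_transl_def)
    ultimately show ?thesis unfolding b by blast
  qed
  show ?thesis using assms(2) * unfolding agree_iff by blast
qed

subsection \<open>Tilings with finite local complexity\<close>

lemma card_transl: "card (transl g P) = card P"
  unfolding transl_def by (rule card_image) (rule inj_on_subset[OF inj_tile_transl], simp)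

lemma transl_class_eq_iff: "transl_class P = transl_class Q \<longleftrightarrow> (\<exists>g. Q = transl g P)"
proof
  assume "transl_class P = transl_class Q"
  moreover have "transl 0 Q \<in> transl_class Q" unfolding transl_class_def by (rule rangeI)
  ultimately have "Q \<in> transl_class P" by simp
  then show "\<exists>g. Q = transl g P" by (auto simp: transl_class_def)
next
  have *: "transl_class (transl g P) \<subseteq> transl_class P" for g and P :: "('a, 'b) tile set"
    by (auto simp: transl_class_def transl_add)
  assume "\<exists>g. Q = transl g P"
  then obtain g where "Q = transl g P" by blast
  then have "P = transl (- g) Q" by (simp add: transl_add)
  then show "transl_class P = transl_class Q"
    using *[of g P] *[of "- g" Q] \<open>Q = transl g P\<close> by auto
qed

text \<open>Otherwise \<open>K\<close> would be mapped into itself by the nonzero step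
  \<open>u - v\<close> and would contain an unbounded arithmetic progression.\<close>

lemma bounded_translate_eqD:
  fixes K :: "'a::real_normed_vector set"
  assumes "bounded K" "K \<noteq> {}" "(\<lambda>x. x + u) ` K = (\<lambda>x. x + v) ` K"
  shows "u = v"
proof (rule ccontr)
  assume "u \<noteq> v"
  obtain p where p: "p \<in> K" using assms(2) by blast
  have step: "x + (u - v) \<in> K" if "x \<in> K" for x
  proof -
    have "x + u \<in> (\<lambda>x. x + v) ` K" using that assms(3) by blast
    then obtain y where "y \<in> K" "x + u = y + v" by blast
    moreover from this(2) have "x + (u - v) = y" by (simp add: algebra_simps)
    ultimately show ?thesis by simp
  qed
  have mem: "p + real n *\<^sub>R (u - v) \<in> K" for n
  proof (induction n)
    case (Suc n)
    from step[OF this] show ?case by (simp add: algebra_simps)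
  qed (simp add: p)
  obtain B where B: "\<And>x. x \<in> K \<Longrightarrow> norm x \<le> B" using assms(1) by (auto simp: bounded_iff)
  have "0 < norm (u - v)" using \<open>u \<noteq> v\<close> by simp
  then obtain n where n: "B + norm p < real n * norm (u - v)" using ex_less_of_nat_mult by blast
  have "real n * norm (u - v) = norm ((p + real n *\<^sub>R (u - v)) - p)" by simp
  also have "\<dots> \<le> norm (p + real n *\<^sub>R (u - v)) + norm p" by (rule norm_triangle_ineq4)
  also have "\<dots> \<le> B + norm p" using B[OF mem] by simp
  finally show False using n by simp
qed

locale flc_tiling =
  fixes T :: "('n::finite, 'l) tile set"
  assumes tiling: "is_tiling T" and flc: "FLC T"
begin

lemma cover: obtains t where "t \<in> T" "x \<in> supp t"
proof -
  have "x \<in> (\<Union>t\<in>T. supp t)" using tiling by (simp add: is_tiling_def)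
  then show thesis using that by blast
qed

lemma tile_eqI:
  assumes "s \<in> T" "t \<in> T" "x \<in> interior (supp s)" "x \<in> supp t"
  shows "s = t"
proof (rule ccontr)
  assume "s \<noteq> t"
  then have "interior (supp s) \<inter> interior (supp t) = {}"
    using tiling assms(1,2) by (auto simp: is_tiling_def)
  moreover have "x \<in> closure (interior (supp t))"
    using tiling assms(2,4) by (auto simp: is_tiling_def is_tile_def)
  ultimately show False
    using assms(3) open_Int_closure_eq_empty[of "interior (supp s)" "interior (supp t)"] by auto
qed

text \<open>Every tile is a translate of one of finitely many representatives, one for each label,
  and the union of their supports is compact.\<close>

lemma tile_diameter_bound:
  "\<exists>D>0. \<forall>t\<in>T. \<forall>x\<in>supp t. \<forall>y\<in>supp t. dist x y \<le> D"
proof -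
  define rep where "rep l = (SOME t. t \<in> T \<and> label t = l)" for l
  have rep: "rep (label t) \<in> T \<and> label (rep (label t)) = label t" if "t \<in> T" for t
    unfolding rep_def by (rule someI_ex) (use that in blast)
  define K where "K = (\<Union>l\<in>label ` T. supp (rep l))"
  have "compact K" unfolding K_def
    using tiling rep by (intro compact_UN) (auto simp: is_tiling_def is_tile_def)
  then obtain a e where e: "\<And>x. x \<in> K \<Longrightarrow> dist a x \<le> e"
    using compact_imp_bounded unfolding bounded_def by metis
  show ?thesis
  proof (intro exI[of _ "2 * \<bar>e\<bar> + 1"] conjI ballI)
    fix t x y assume t: "t \<in> T" and x: "x \<in> supp t" and y: "y \<in> supp t"
    obtain g where g: "t = tile_transl g (rep (label t))"
      using tiling rep[OF t] t unfolding is_tiling_def by metis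
    have "x - g \<in> supp (rep (label t))" "y - g \<in> supp (rep (label t))"
      using x y g mem_supp_tile_transl by metis+
    then have "dist a (x - g) \<le> e" "dist a (y - g) \<le> e" using e t by (auto simp: K_def)
    then have "dist (x - g) (y - g) \<le> 2 * \<bar>e\<bar>" using dist_triangle3[of "x - g" "y - g" a] by simp
    then show "dist x y \<le> 2 * \<bar>e\<bar> + 1" by (simp add: dist_norm)
  qed simp
qed

lemma meeting_extent:
  assumes "\<forall>t\<in>T. \<forall>x\<in>supp t. \<forall>y\<in>supp t. dist x y \<le> D"
    and "p \<in> patch_supp (meeting T (cball x r))"
  shows "dist x p \<le> r + D"
proof -
  obtain t y where "t \<in> T" "p \<in> supp t" "y \<in> supp t" "dist x y \<le> r"
    using assms(2) by (auto simp: patch_supp_def mem_meeting_cball)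
  then show ?thesis using assms(1) dist_triangle[of x p y] by fastforce
qed

lemma cball_subset_patch_supp: "cball x r \<subseteq> patch_supp (meeting T (cball x r))"
proof
  fix p assume "p \<in> cball x r"
  moreover obtain t where "t \<in> T" "p \<in> supp t" by (rule cover)
  ultimately have "t \<in> meeting T (cball x r)" by (auto simp: meeting_def)
  with \<open>p \<in> supp t\<close> show "p \<in> patch_supp (meeting T (cball x r))"
    unfolding patch_supp_def by blast
qed

lemma diameter_patch_in_ball:
  obtains R where "R > 0" "\<And>P x. P \<subseteq> meeting T (cball x r) \<Longrightarrow> diameter (patch_supp P) < R"
proof -
  obtain D where D: "D > 0" "\<forall>t\<in>T. \<forall>x\<in>supp t. \<forall>y\<in>supp t. dist x y \<le> D"
    using tile_diameter_bound by blast
  show thesis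
  proof (rule that[of "2 * (\<bar>r\<bar> + D) + 1"])
    fix P x assume P: "P \<subseteq> meeting T (cball x r)"
    have "diameter (patch_supp P) \<le> 2 * (\<bar>r\<bar> + D)"
    proof (rule diameter_le)
      fix p q assume "p \<in> patch_supp P" "q \<in> patch_supp P"
      then have "p \<in> patch_supp (meeting T (cball x r))" "q \<in> patch_supp (meeting T (cball x r))"
        using P by (auto simp: patch_supp_def)
      then have "dist x p \<le> r + D" "dist x q \<le> r + D" using meeting_extent[OF D(2)] by blast+
      then show "norm (p - q) \<le> 2 * (\<bar>r\<bar> + D)"
        using dist_triangle3[of p q x] by (simp add: dist_norm)
    qed (use D(1) in auto)
    then show "diameter (patch_supp P) < 2 * (\<bar>r\<bar> + D) + 1" by simp
  qed (use D(1) in auto)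
qed

text \<open>Translates of a patch have equally many tiles, so infinitely many tiles near a ball would
  produce infinitely many classes of patches of bounded diameter.\<close>

lemma finite_meeting: "finite (meeting T (cball x r))"
proof (rule ccontr)
  assume inf: "infinite (meeting T (cball x r))"
  obtain R where R: "R > 0" "\<And>P. P \<subseteq> meeting T (cball x r) \<Longrightarrow> diameter (patch_supp P) < R"
    using diameter_patch_in_ball[of r] by metis
  define \<P> where "\<P> = {P. is_patch T P \<and> diameter (patch_supp P) < R}"
  have fin: "finite (transl_class ` \<P>)" using flc R(1) unfolding FLC_def \<P>_def by blast
  define \<kappa> where "\<kappa> C = card (SOME P. P \<in> C)" for C :: "('n, 'l) tile set set"
  have \<kappa>: "\<kappa> (transl_class P) = card P" for P
  proof -
    have "(SOME Q. Q \<in> transl_class P) \<in> transl_class P"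
      by (rule someI_ex) (auto simp: transl_class_def)
    then show ?thesis unfolding \<kappa>_def by (auto simp: transl_class_def card_transl)
  qed
  have "n \<in> \<kappa> ` transl_class ` \<P>" for n
  proof -
    obtain P where P: "finite P" "card P = n" "P \<subseteq> meeting T (cball x r)"
      using infinite_arbitrarily_large[OF inf] by blast
    then have "P \<in> \<P>" using R(2) by (auto simp: \<P>_def is_patch_def meeting_def)
    then have "transl_class P \<in> transl_class ` \<P>" by (rule imageI)
    then have "\<kappa> (transl_class P) \<in> \<kappa> ` transl_class ` \<P>" by (rule imageI)
    then show ?thesis using \<kappa>[of P] P(2) by simp
  qed
  then have "\<kappa> ` transl_class ` \<P> = UNIV" by blast
  then show False using finite_imageI[OF fin, of \<kappa>] by simp
qed

lemma is_patch_meeting: "is_patch T (meeting T (cball x r))"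
  using finite_meeting by (auto simp: is_patch_def meeting_def)

text \<open>The loss of radius is unavoidable: a further tile may touch the translated closed ball
  from outside.\<close>

lemma agree_of_transl_subset:
  assumes sub: "transl g (meeting T (cball x r)) \<subseteq> T" and "r' < r"
  shows "agree T (x + g) x r'"
  unfolding agree_iff
proof (intro conjI ballI)
  fix t assume "t \<in> meeting T (cball x r')"
  then have "t \<in> meeting T (cball x r)" using \<open>r' < r\<close> by (force simp: mem_meeting_cball)
  then show "tile_transl (x + g - x) t \<in> T" using sub by (auto simp: transl_def)
next
  fix t assume "t \<in> meeting T (cball (x + g) r')"
  then obtain p where p: "t \<in> T" "p \<in> supp t" "dist (x + g) p \<le> r'"
    by (auto simp: mem_meeting_cball)
  \<comment> \<open>The margin \<open>r - r'\<close> leaves room for an interior point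
    \<open>q\<close> of \<open>t\<close> in the larger ball. The patch tile covering
    \<open>q - g\<close>, translated by \<open>g\<close>, contains \<open>q\<close> and so must be
    \<open>t\<close>.\<close>
  have "p \<in> closure (interior (supp t))" using tiling p by (auto simp: is_tiling_def is_tile_def)
  then obtain q where q: "q \<in> interior (supp t)" "dist q p < r - r'"
    using \<open>r' < r\<close> unfolding closure_approachable by (meson diff_gt_0_iff_gt)
  obtain s where s: "s \<in> T" "q - g \<in> supp s" by (rule cover)
  have "dist (x + g) q < r" using p(3) q(2) dist_triangle2[of "x + g" q p] by simp
  then have "dist x (q - g) \<le> r" by (simp add: dist_norm algebra_simps)
  then have "s \<in> meeting T (cball x r)" using s by (auto simp: mem_meeting_cball)
  then have "tile_transl g s \<in> T" using sub by (auto simp: transl_def)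
  then have "t = tile_transl g s"
    using tile_eqI[OF p(1) _ q(1)] s(2) by (simp add: mem_supp_tile_transl)
  then show "tile_transl (x - (x + g)) t \<in> T" using s(1) by (simp add: tile_transl_add)
qed

text \<open>Each such \<open>u\<close> carries a fixed tile at the origin to a tile of
  \<open>T\<close> meeting the ball. Different \<open>u\<close> give different tiles, since the
  support is bounded and nonempty.\<close>

lemma finite_agreeing_points: "finite {u \<in> cball 0 G. agree T u 0 0}"
proof -
  obtain t where t: "t \<in> T" "0 \<in> supp t" by (rule cover)
  have sub: "(\<lambda>u. tile_transl u t) ` {u \<in> cball 0 G. agree T u 0 0} \<subseteq> meeting T (cball 0 G)"
  proof (rule image_subsetI)
    fix u assume "u \<in> {u \<in> cball 0 G. agree T u 0 0}"
    then have u: "u \<in> cball 0 G" "agree T u 0 0" by simp_all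
    have "t \<in> meeting T (cball 0 0)" using t by (auto simp: meeting_def)
    then have "tile_transl (u - 0) t \<in> T" using u(2) unfolding agree_iff by blast
    then have "tile_transl u t \<in> T" by simp
    moreover have "u \<in> supp (tile_transl u t)" using t(2) by (simp add: mem_supp_tile_transl)
    ultimately show "tile_transl u t \<in> meeting T (cball 0 G)"
      using u(1) unfolding meeting_def by blast
  qed
  have "inj_on (\<lambda>u. tile_transl u t) {u \<in> cball 0 G. agree T u 0 0}"
  proof (rule inj_onI)
    fix u v assume "tile_transl u t = tile_transl v t"
    then have eq: "(\<lambda>x. x + u) ` supp t = (\<lambda>x. x + v) ` supp t" by (simp add: tile_transl_def)
    have "compact (supp t)" using tiling t(1) by (auto simp: is_tiling_def is_tile_def)
    then have "bounded (supp t)" by (rule compact_imp_bounded)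
    then show "u = v" using eq t(2) by (intro bounded_translate_eqD[of "supp t" u v]) auto
  qed
  then show ?thesis using sub finite_meeting inj_on_finite by blast
qed

end

subsection \<open>Repetitivity\<close>

lemma recurs_within_mono: "recurs_within T P R \<Longrightarrow> R \<le> R' \<Longrightarrow> recurs_within T P R'"
  unfolding recurs_within_def by (meson less_le_trans order_trans subset_cball)

context flc_tiling
begin

text \<open>\<open>LEAST\<close> over the reals is informative only if the infimum is attained. Near
  any \<open>x\<close> only finitely many translates of \<open>P\<close> compete, and the ball
  inside \<open>patch_supp P\<close> keeps the infimum positive.\<close>

lemma recurs_within_rep_radius:
  assumes P: "P \<subseteq> meeting T (cball y e)" and r: "r > 0" "cball z r \<subseteq> patch_supp P"
    and ex: "recurs_within T P R1"
  shows "recurs_within T P (rep_radius T P)"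
    and "recurs_within T P R \<Longrightarrow> rep_radius T P \<le> R"
proof -
  define I where "I = {R. recurs_within T P R}"
  define m where "m = Inf I"
  have low: "r \<le> R" if "R \<in> I" for R
  proof -
    have "recurs_within T P R" using that by (simp add: I_def)
    then obtain g where g: "patch_supp (transl g P) \<subseteq> cball 0 R"
      unfolding recurs_within_def by blast
    have "cball (z + g) r \<subseteq> patch_supp (transl g P)"
    proof
      fix p assume "p \<in> cball (z + g) r"
      then have "p - g \<in> cball z r" by (simp add: dist_norm algebra_simps)
      then have "p - g \<in> patch_supp P" using r(2) by blast
      then show "p \<in> patch_supp (transl g P)" unfolding patch_supp_transl by force
    qed
    then have "cball (z + g) r \<subseteq> cball 0 R" using g by blast
    then show ?thesis
      using r(1) zero_le_dist[of "z + g" 0] unfolding cball_subset_cball_iff by linarith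
  qed
  have bdd: "bdd_below I" using low by (rule bdd_belowI)
  have "I \<noteq> {}" using ex by (auto simp: I_def)
  then have m: "m > 0" unfolding m_def using low r(1) cInf_greatest[of I r] by fastforce
  have "recurs_within T P m"
    unfolding recurs_within_def
  proof (intro conjI allI m)
    fix x
    define \<Q> where "\<Q> = {P'. P' \<subseteq> meeting T (cball x (m + 1)) \<and> (\<exists>g. P' = transl g P)}"
    have fin: "finite \<Q>" unfolding \<Q>_def using finite_meeting by simp
    have Q: "\<exists>P'\<in>\<Q>. patch_supp P' \<subseteq> cball x R" if R: "R > m" "R < m + 1" for R
    proof -
      obtain R' where "R' \<in> I" "R' < R"
        using R(1) \<open>I \<noteq> {}\<close> unfolding m_def using cInf_lessD by blast
      then have "recurs_within T P R" using recurs_within_mono[of T P R' R] by (simp add: I_def)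
      then obtain P' g where P': "is_patch T P'" "P' = transl g P" "patch_supp P' \<subseteq> cball x R"
        unfolding recurs_within_def by blast
      have "t \<in> meeting T (cball x (m + 1))" if t: "t \<in> P'" for t
      proof -
        have "supp t \<noteq> {}" using P P'(2) t by (auto simp: transl_def meeting_def supp_tile_transl)
        moreover have "supp t \<subseteq> cball x (m + 1)"
          using P'(3) t R(2) by (force simp: patch_supp_def)
        ultimately show ?thesis using P'(1) t by (auto simp: is_patch_def meeting_def)
      qed
      then show ?thesis using P'(2,3) unfolding \<Q>_def by blast
    qed
    have "\<exists>P'\<in>\<Q>. patch_supp P' \<subseteq> cball x m"
    proof (rule ccontr)
      assume "\<not> ?thesis"
      then have "\<forall>P'\<in>\<Q>. \<exists>p. p \<in> patch_supp P' \<and> m < dist x p" by (force simp: subset_iff)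
      then obtain p where p: "\<And>P'. P' \<in> \<Q> \<Longrightarrow> p P' \<in> patch_supp P' \<and> m < dist x (p P')"
        by metis
      \<comment> \<open>\<open>M\<close> is the least overshoot among the candidates, capped at
        \<open>m + 1\<close> so that \<open>\<Q>\<close> contains all competitors. A radius strictly
        between \<open>m\<close> and \<open>M\<close> admits a copy of \<open>P\<close>, although
        every candidate exceeds it.\<close>
      define M where "M = Min (insert (m + 1) ((\<lambda>P'. dist x (p P')) ` \<Q>))"
      have "m < M" unfolding M_def using fin p by (subst Min_gr_iff) auto
      then obtain R where R: "m < R" "R < M" using dense by blast
      have "M \<le> m + 1" unfolding M_def using fin by simp
      with R obtain P' where P': "P' \<in> \<Q>" "patch_supp P' \<subseteq> cball x R" using Q[of R] by auto
      have "M \<le> dist x (p P')" unfolding M_def using fin P'(1) by (intro Min_le) auto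
      moreover have "dist x (p P') \<le> R" using p[OF P'(1)] P'(2) by auto
      ultimately show False using R by simp
    qed
    then show "\<exists>P'. is_patch T P' \<and> (\<exists>g. P' = transl g P) \<and> patch_supp P' \<subseteq> cball x m"
    proof (elim bexE)
      fix P' assume P': "P' \<in> \<Q>" "patch_supp P' \<subseteq> cball x m"
      then have sub: "P' \<subseteq> meeting T (cball x (m + 1))" by (simp add: \<Q>_def)
      then have "finite P'" by (rule finite_subset) (rule finite_meeting)
      moreover have "P' \<subseteq> T" using sub by (auto simp: meeting_def)
      ultimately show ?thesis using P' unfolding \<Q>_def is_patch_def by blast
    qed
  qed
  moreover have least: "m \<le> R" if "recurs_within T P R" for R
    unfolding m_def using bdd that by (intro cInf_lower) (auto simp: I_def)
  ultimately have "rep_radius T P = m"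
    unfolding rep_radius_def by (intro Least_equality)
  then show "recurs_within T P (rep_radius T P)"
    and "recurs_within T P R \<Longrightarrow> rep_radius T P \<le> R"
    using \<open>recurs_within T P m\<close> least by auto
qed

text \<open>Agreement at every point keeps all translated tiles inside \<open>T\<close>. Using this
  for \<open>h\<close> and for \<open>- h\<close> turns the inclusion into equality, so
  \<open>h\<close> is a period.\<close>

lemma nonperiodic_agree:
  assumes "nonperiodic T" "\<And>z. agree T z (z + h) 0"
  shows "h = 0"
proof -
  have *: "transl h T \<subseteq> T" if a: "\<And>z. agree T (z + h) z 0" for h
  proof
    fix s assume "s \<in> transl h T"
    then obtain t where t: "t \<in> T" "s = tile_transl h t" by (auto simp: transl_def)
    show "s \<in> T"
    \<comment> \<open>\<open>is_tile\<close> admits an empty support. Such a tile meets no ball, but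
      every translation fixes it.\<close>
    proof (cases "supp t = {}")
      case True
      then have "s = t" using t(2) by (simp add: tile_transl_def prod_eq_iff)
      then show ?thesis using t(1) by simp
    next
      case False
      then obtain z where "z \<in> supp t" by blast
      then have "t \<in> meeting T (cball z 0)" using t(1) by (auto simp: meeting_def)
      then have "tile_transl (z + h - z) t \<in> T" using a[of z] unfolding agree_iff by blast
      then show ?thesis using t(2) by simp
    qed
  qed
  have "transl h T \<subseteq> T" using assms(2) agree_sym by (intro *) blast
  moreover have "transl (- h) T \<subseteq> T"
  proof (rule *)
    fix z show "agree T (z + - h) z 0" using assms(2)[of "z - h"] by simp
  qed
  then have "transl h (transl (- h) T) \<subseteq> transl h T" unfolding transl_def by blast
  then have "T \<subseteq> transl h T" by (simp add: transl_add)
  ultimately show ?thesis using assms(1) unfolding nonperiodic_def by blast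
qed

end

locale rep_tiling = flc_tiling T for T :: "('n::finite, 'l) tile set" +
  assumes rep: "repetitive T"
begin

text \<open>Finite local complexity leaves finitely many classes of patches around balls of a given
  radius. The sum of their recurrence radii serves all of them at once.\<close>

lemma uniformly_repetitive: "\<exists>G>0. \<forall>z x. \<exists>y. dist x y \<le> G \<and> agree T z y r"
proof -
  \<comment> \<open>The larger radius pays for the loss in
    \<open>agree_of_transl_subset\<close>.\<close>
  define e where "e = \<bar>r\<bar> + 1"
  have e: "r < e" "e \<ge> 0" by (auto simp: e_def)
  define Q where "Q z = meeting T (cball z e)" for z
  obtain R where R: "R > 0" "\<And>P x. P \<subseteq> meeting T (cball x e) \<Longrightarrow> diameter (patch_supp P) < R"
    using diameter_patch_in_ball[of e] by metis
  have "range (\<lambda>z. transl_class (Q z)) \<subseteq>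
      transl_class ` {P. is_patch T P \<and> diameter (patch_supp P) < R}"
    using R(2)[OF subset_refl] is_patch_meeting by (fastforce simp: Q_def)
  moreover have "finite (transl_class ` {P. is_patch T P \<and> diameter (patch_supp P) < R})"
    using flc R(1) by (simp add: FLC_def)
  ultimately have "finite (range (\<lambda>z. transl_class (Q z)))" by (rule finite_subset)
  then obtain Z where Z: "finite Z" "range (\<lambda>z. transl_class (Q z)) = (\<lambda>z. transl_class (Q z)) ` Z"
    using finite_subset_image[of "range (\<lambda>z. transl_class (Q z))" "\<lambda>z. transl_class (Q z)" UNIV]
    by auto
  have "\<forall>z. \<exists>R. recurs_within T (Q z) R"
    using rep is_patch_meeting unfolding repetitive_def Q_def by blast
  then obtain \<rho> where \<rho>: "\<And>z. recurs_within T (Q z) (\<rho> z)" by metis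
  then have pos: "\<rho> z > 0" for z by (simp add: recurs_within_def)
  have "\<exists>y. dist x y \<le> (\<Sum>z\<in>Z. \<rho> z) + 1 \<and> agree T z y r" for z x
  proof -
    obtain a where a: "a \<in> Z" "transl_class (Q z) = transl_class (Q a)" using Z(2) by blast
    then obtain g where g: "Q a = transl g (Q z)" by (auto simp: transl_class_eq_iff)
    obtain h where h: "transl h (Q a) \<subseteq> T" "patch_supp (transl h (Q a)) \<subseteq> cball x (\<rho> a)"
      using \<rho>[of a] unfolding recurs_within_def is_patch_def by metis
    have gh: "transl h (Q a) = transl (g + h) (Q z)" by (simp add: g transl_add)
    have ag: "agree T (z + (g + h)) z r"
      by (rule agree_of_transl_subset[OF _ e(1)]) (use h(1) gh in \<open>simp add: Q_def\<close>)
    have "z \<in> patch_supp (Q z)" unfolding Q_def using cball_subset_patch_supp e(2) by fastforce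
    then have "z + (g + h) \<in> patch_supp (transl h (Q a))" unfolding gh patch_supp_transl by blast
    then have "dist x (z + (g + h)) \<le> \<rho> a" using h(2) by auto
    also have "\<rho> a \<le> (\<Sum>z\<in>Z. \<rho> z)"
      using Z(1) a(1) pos by (intro member_le_sum) (auto intro: less_imp_le)
    finally show ?thesis using agree_sym[OF ag] by (intro exI[of _ "z + (g + h)"]) simp
  qed
  moreover have "(\<Sum>z\<in>Z. \<rho> z) + 1 > 0" using pos sum_nonneg[of Z \<rho>] by (smt (verit))
  ultimately show ?thesis by blast
qed

end

subsection \<open>Unique composition\<close>

lemma finite_if_separated:
  fixes S :: "'a::euclidean_space set"
  assumes "bounded S" "\<delta> > 0" "\<And>x y. x \<in> S \<Longrightarrow> y \<in> S \<Longrightarrow> x \<noteq> y \<Longrightarrow> \<delta> \<le> dist x y"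
  shows "finite S"
proof -
  have "compact (closure S)" using assms(1) by (simp add: compact_closure)
  then obtain K where K: "finite K" "closure S \<subseteq> (\<Union>x\<in>K. ball x (\<delta>/2))"
    using assms(2) unfolding compact_eq_totally_bounded by (meson half_gt_zero)
  then have "\<forall>x\<in>S. \<exists>k. k \<in> K \<and> dist k x < \<delta>/2" using closure_subset by (fastforce simp: subset_iff)
  then obtain k where k: "\<And>x. x \<in> S \<Longrightarrow> k x \<in> K \<and> dist (k x) x < \<delta>/2" by metis
  have "inj_on k S"
  proof (rule inj_onI, rule ccontr)
    fix x y assume xy: "x \<in> S" "y \<in> S" "k x = k y" "x \<noteq> y"
    have "dist x y \<le> dist (k x) x + dist (k x) y" by (rule dist_triangle3)
    also have "\<dots> < \<delta>" using k[OF xy(1)] k[OF xy(2)] xy(3) by simp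
    finally show False using assms(3)[OF xy(1,2,4)] by simp
  qed
  then show ?thesis using k K(1) by (auto intro: inj_on_finite)
qed

lemma ex_power_between:
  fixes c s :: real
  assumes "c > 1" "s \<ge> 1"
  shows "\<exists>n. c ^ n \<le> s \<and> s < c ^ Suc n"
proof -
  define m where "m = (LEAST m. s < c ^ m)"
  have m: "s < c ^ m" unfolding m_def using real_arch_pow[OF assms(1)] by (rule LeastI_ex)
  have "m \<noteq> 0" using m assms(2) by (intro notI) simp
  then obtain n where n: "m = Suc n" using not0_implies_Suc by blast
  then have "\<not> s < c ^ n" using not_less_Least[of n "\<lambda>m. s < c ^ m"] by (simp add: m_def)
  then show ?thesis using m n by (intro exI[of _ n]) simp
qed

text \<open>\<open>inflate\<close> is the form in which local derivability of \<open>T\<close> from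
  its image under \<open>f\<close> is used: expansion of the radius, up to a constant loss. The
  constants are left open so that the square of a given similitude also fits.\<close>

locale inflated_tiling = rep_tiling T for T :: "('n::finite, 'l) tile set" +
  fixes f :: "real ^ 'n \<Rightarrow> real ^ 'n" and c \<rho> :: real
  assumes nonper: "nonperiodic T"
    and lin: "linear f" and sim: "norm (f x - f y) = c * norm (x - y)" and c: "c > 1"
    and rho: "\<rho> \<ge> 0"
    and inflate: "agree T x y r \<Longrightarrow> agree T (f x) (f y) (c * r - \<rho>)"
begin

text \<open>The fixed point of the map from \<open>r\<close> to \<open>c * r - \<rho>\<close>: each
  inflation multiplies the excess of a radius over \<open>b\<close> by exactly
  \<open>c\<close>.\<close>

definition b where "b = \<rho> / (c - 1)"

lemma b: "b \<ge> 0" "c * b - \<rho> = b"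
  using c rho by (auto simp: b_def field_simps)

lemma cn: "c ^ n > 0" "c ^ n \<ge> 1"
  using c by (auto intro: one_le_power)

lemma lin_n: "linear (f ^^ n)" and sim_n: "norm ((f ^^ n) x - (f ^^ n) y) = c ^ n * norm (x - y)"
  using funpow_similitude[of f c, OF lin sim] by auto

lemma norm_n: "norm ((f ^^ n) x) = c ^ n * norm x"
  using sim_n[of n x 0] by (simp add: linear_0[OF lin_n])

lemma inj_n: "inj (f ^^ n)" and surj_n: "surj (f ^^ n)"
  using similitude_inj[of "f ^^ n" "c ^ n"] similitude_surj[of "f ^^ n" "c ^ n"] lin_n sim_n cn
  by auto

lemma preimage_n: obtains x' where "(f ^^ n) x' = x"
  using surj_n[of n] by (metis surjD)

lemma inflate_n: "agree T x y r \<Longrightarrow> agree T ((f ^^ n) x) ((f ^^ n) y) (c ^ n * (r - b) + b)"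
proof (induction n)
  case (Suc n)
  have "c * (c ^ n * (r - b) + b) - \<rho> = c ^ Suc n * (r - b) + b" using b by (simp add: algebra_simps)
  then show ?case using inflate[OF Suc.IH[OF Suc.prems]] by simp
qed simp

text \<open>Uniform repetitivity at the single radius \<open>c + b\<close> is inflated by the power
  of \<open>f\<close> with \<open>c ^ n \<le> s < c ^ Suc n\<close>. The radius becomes
  \<open>c ^ Suc n + b\<close>, which exceeds \<open>s\<close>, and distances grow to at most
  \<open>G * s\<close>.\<close>

lemma linearly_repetitive:
  "\<exists>C>0. \<forall>s\<ge>1. \<forall>z x. \<exists>y. dist x y \<le> C * s \<and> agree T z y s"
proof -
  obtain G where G: "G > 0" "\<And>z x. \<exists>y. dist x y \<le> G \<and> agree T z y (c + b)"
    using uniformly_repetitive by blast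
  have "\<exists>y. dist x y \<le> G * s \<and> agree T z y s" if s: "s \<ge> 1" for s z x
  proof -
    obtain n where n: "c ^ n \<le> s" "s < c ^ Suc n" using ex_power_between[OF c s] by blast
    obtain x' z' where x': "(f ^^ n) x' = x" and z': "(f ^^ n) z' = z" by (metis preimage_n)
    obtain y where y: "dist x' y \<le> G" "agree T z' y (c + b)" using G(2) by blast
    have "dist x ((f ^^ n) y) = c ^ n * dist x' y" by (simp add: dist_norm sim_n flip: x')
    also have "\<dots> \<le> s * G" using y(1) n(1) cn(1)[of n] by (intro mult_mono) auto
    finally have "dist x ((f ^^ n) y) \<le> G * s" by (simp add: mult.commute)
    moreover have "agree T z ((f ^^ n) y) s"
      using inflate_n[OF y(2), of n] b n(2) by (auto simp: z' mult.commute elim: agree_mono)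
    ultimately show ?thesis by blast
  qed
  then show ?thesis using G(1) by blast
qed

text \<open>If \<open>x\<close> and \<open>x + h\<close> agreed too far, linear repetitivity would
  place a copy of the surroundings of any \<open>z\<close>, of radius at least
  \<open>norm h\<close>, inside the agreeing ball. Then \<open>z\<close> would agree with
  \<open>z + h\<close> for all \<open>z\<close>, making \<open>h\<close> a period.\<close>

lemma repulsion: "\<exists>C>0. \<forall>x h r. h \<noteq> 0 \<longrightarrow> agree T x (x + h) r \<longrightarrow> r < C * max (norm h) 1"
proof -
  obtain C where C: "C > 0" "\<And>s z x. s \<ge> 1 \<Longrightarrow> \<exists>y. dist x y \<le> C * s \<and> agree T z y s"
    using linearly_repetitive by blast
  have "r < C * max (norm h) 1" if h: "h \<noteq> 0" and a: "agree T x (x + h) r" for x h r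
  proof (rule ccontr)
    assume r: "\<not> r < C * max (norm h) 1"
    define s where "s = max (norm h) 1"
    have s: "s \<ge> 1" "norm h \<le> s" "C * s \<le> r" using r by (auto simp: s_def)
    have "agree T z (z + h) 0" for z
    proof -
      obtain y where y: "dist x y \<le> C * s" "agree T z y s" using C(2) s(1) by blast
      have "agree T z y 0" by (rule agree_mono[OF y(2)]) (use s in simp)
      moreover have "agree T y (y + h) 0"
        using y(1) s(3) by (intro agree_shift'[OF a]) (auto simp: dist_norm norm_minus_commute)
      moreover have "agree T (y + h) (z + h) 0"
        using s(2) by (intro agree_shift[OF agree_sym[OF y(2)]]) simp
      ultimately show ?thesis by (meson agree_trans)
    qed
    then show False using nonperiodic_agree[OF nonper] h by blast
  qed
  then show ?thesis using C(1) by blast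
qed

text \<open>Whether \<open>f\<^sup>n u\<close> and \<open>f\<^sup>n v\<close> have the same surroundings at scale \<open>c\<^sup>n\<close> can only change from
  false to true as \<open>n\<close> grows.  For fixed \<open>u\<close>, repulsion keeps the bounded set of such \<open>v\<close>
  uniformly separated, so these sets stabilise at some level \<open>p\<close>; agreement at level \<open>p + 1\<close>
  then yields agreement at level \<open>p\<close>, and every point is a point of level \<open>p + 1\<close>.\<close>

lemma recognizable: "\<exists>\<sigma>\<ge>0. \<forall>x y. agree T (f x) (f y) \<sigma> \<longrightarrow> agree T x y 0"
proof -
  obtain C where C: "C > 0" "\<And>x h r. h \<noteq> 0 \<Longrightarrow> agree T x (x + h) r \<Longrightarrow> r < C * max (norm h) 1"
    using repulsion by blast
  obtain G where G: "G > 0" "\<And>z x. \<exists>y. dist x y \<le> G \<and> agree T z y (2 + b)"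
    using uniformly_repetitive by blast
  \<comment> \<open>The radius \<open>c ^ n + b\<close> is carried to \<open>c ^ Suc n + b\<close>
    by inflation, so the sets increase with \<open>n\<close>. The extra 1 in \<open>G + 1\<close>
    allows for a later shift by a vector of norm at most 1.\<close>
  define E where "E n u = {v \<in> cball 0 (G + 1). agree T ((f ^^ n) u) ((f ^^ n) v) (c ^ n + b)}" for n u
  have E_mono: "E n u \<subseteq> E m u" if "n \<le> m" for n m u
    using that
  proof (induction rule: dec_induct)
    case (step m)
    have "c * (c ^ m + b) - \<rho> = c ^ Suc m + b" using b by (simp add: algebra_simps)
    then have "E m u \<subseteq> E (Suc m) u" using inflate[of _ _ "c ^ m + b"] by (auto simp: E_def)
    then show ?case using step.IH by blast
  qed simp
  have finE: "finite (\<Union>n. E n u)" for u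
  proof (rule finite_if_separated)
    show "bounded (\<Union>n. E n u)" by (rule bounded_subset[OF bounded_cball[of 0 "G + 1"]]) (auto simp: E_def)
    show "1 / C > 0" using C(1) by simp
    fix v v' assume v: "v \<in> (\<Union>n. E n u)" "v' \<in> (\<Union>n. E n u)" "v \<noteq> v'"
    then obtain n1 n2 where n12: "v \<in> E n1 u" "v' \<in> E n2 u" by blast
    \<comment> \<open>Raising the common level beyond \<open>n3\<close> forces
      \<open>c ^ n > C\<close>. The maximum in the repulsion estimate is then not 1, and the factor
      \<open>c ^ n\<close> cancels.\<close>
    obtain n3 where n3: "C < c ^ n3" using real_arch_pow[OF c] by blast
    define n where "n = n1 + n2 + n3"
    have "v \<in> E n u" "v' \<in> E n u" using n12 E_mono[of n1 n] E_mono[of n2 n] by (auto simp: n_def)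
    then have "agree T ((f ^^ n) v) ((f ^^ n) v') (c ^ n + b)"
      unfolding E_def using agree_sym agree_trans by blast
    moreover have "(f ^^ n) v \<noteq> (f ^^ n) v'" using v(3) inj_n by (auto dest: injD)
    ultimately have "c ^ n + b < C * max (norm ((f ^^ n) v' - (f ^^ n) v)) 1"
      using C(2)[of "(f ^^ n) v' - (f ^^ n) v" "(f ^^ n) v"] by simp
    then have *: "c ^ n < C * max (c ^ n * norm (v' - v)) 1" using b by (simp add: sim_n)
    have "c ^ n3 \<le> c ^ n" using c by (intro power_increasing) (auto simp: n_def)
    then have "c ^ n > C" using n3 by simp
    then have "c ^ n < C * (c ^ n * norm (v' - v))" using * by (auto simp: max_def split: if_splits)
    then have "c ^ n * 1 < c ^ n * (C * norm (v' - v))" by (simp add: algebra_simps)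
    then have "1 < C * norm (v' - v)" using cn(1)[of n] by (simp only: mult_less_cancel_left_pos)
    then show "1 / C \<le> dist v v'"
      using C(1) by (simp add: dist_norm norm_minus_commute field_simps)
  qed
  \<comment> \<open>Stabilisation is known for each \<open>u\<close> separately. A finite net
    provides one level \<open>p\<close> valid at all its points, and every other \<open>u\<close> is
    moved to a point of the net.\<close>
  obtain K :: "(real ^ 'n) set" where K: "finite K" "cball 0 G \<subseteq> (\<Union>x\<in>K. ball x 1)"
    using compact_cball[of "0 :: real ^ 'n" G] unfolding compact_eq_totally_bounded
    by (elim conjE allE[of _ 1]) auto
  have "\<exists>p. \<forall>a\<in>K. \<forall>n. E n a \<subseteq> E p a"
  proof -
    define W where "W = (SIGMA a:K. \<Union>n. E n a)"
    have W: "finite W" unfolding W_def using K(1) finE by blast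
    define \<nu> where "\<nu> w = (SOME n. snd w \<in> E n (fst w))" for w
    have "v \<in> E (\<Sum>w\<in>W. \<nu> w) a" if "a \<in> K" "v \<in> E n a" for a n v
    proof -
      have mem: "(a, v) \<in> W" using that by (auto simp: W_def)
      have "v \<in> E (\<nu> (a, v)) a" unfolding \<nu>_def fst_conv snd_conv by (rule someI[of _ n]) (rule that)
      moreover have "\<nu> (a, v) \<le> (\<Sum>w\<in>W. \<nu> w)" by (rule member_le_sum[OF mem _ W]) simp
      ultimately show ?thesis using E_mono by blast
    qed
    then show ?thesis by blast
  qed
  then obtain p where p: "\<And>a n. a \<in> K \<Longrightarrow> E n a \<subseteq> E p a" by blast
  \<comment> \<open>One \<open>c ^ Suc p\<close> of the radius is spent on the shift to the net; the
    other is the radius required by \<open>E (Suc p)\<close>. After descending to level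
    \<open>p\<close>, the shift back leaves radius \<open>b\<close>.\<close>
  have "agree T x y 0" if xy: "agree T (f x) (f y) (2 * c ^ Suc p + b)" for x y
  proof -
    obtain X Y where X: "(f ^^ p) X = x" and Y: "(f ^^ p) Y = y" by (metis preimage_n)
    obtain u where u: "norm u \<le> G" "agree T X u (2 + b)" using G(2)[of 0 X] by auto
    obtain v where v: "norm v \<le> G" "agree T Y v (2 + b)" using G(2)[of 0 Y] by auto
    have Xu: "agree T ((f ^^ n) X) ((f ^^ n) u) (2 * c ^ n + b)"
      and Yv: "agree T ((f ^^ n) Y) ((f ^^ n) v) (2 * c ^ n + b)" for n
      using inflate_n[OF u(2), of n] inflate_n[OF v(2), of n] by (simp_all add: mult.commute)
    have "agree T ((f ^^ Suc p) X) ((f ^^ Suc p) Y) (2 * c ^ Suc p + b)" using xy by (simp add: X Y)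
    then have uv: "agree T ((f ^^ Suc p) u) ((f ^^ Suc p) v) (2 * c ^ Suc p + b)"
      using Xu[of "Suc p"] Yv[of "Suc p"] by (meson agree_sym agree_trans)
    obtain a where a: "a \<in> K" "dist a u < 1" using K(2) u(1) by (force simp: subset_iff)
    define w where "w = a - u"
    have w: "a = u + w" "norm w \<le> 1" using a(2) by (auto simp: w_def dist_norm)
    have shift: "c ^ n * norm w \<le> c ^ n" for n using w(2) cn(1)[of n] by (simp add: mult_left_le)
    have "agree T ((f ^^ Suc p) a) ((f ^^ Suc p) (v + w)) (c ^ Suc p + b)"
      unfolding w(1) linear_add[OF lin_n]
      by (rule agree_shift[OF uv]) (use shift[of "Suc p"] norm_n[of "Suc p" w] in simp)
    moreover have "v + w \<in> cball 0 (G + 1)" using norm_triangle_ineq[of v w] v(1) w(2) by simp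
    ultimately have "v + w \<in> E (Suc p) a" by (simp add: E_def)
    then have "v + w \<in> E p a" using p[OF a(1)] by blast
    then have aw: "agree T ((f ^^ p) a) ((f ^^ p) (v + w)) (c ^ p + b)" by (simp add: E_def)
    have "agree T ((f ^^ p) u) ((f ^^ p) v) b"
      by (rule agree_shift'[OF aw]) (use shift[of p] sim_n[of p u a] in
        \<open>auto simp: w(1) linear_add[OF lin_n]\<close>)
    then have "agree T ((f ^^ p) u) ((f ^^ p) v) 0" by (rule agree_mono) (rule b)
    moreover have "agree T x ((f ^^ p) u) 0" "agree T y ((f ^^ p) v) 0"
      using Xu[of p] Yv[of p] b cn(1)[of p] by (auto simp: X Y elim!: agree_mono)
    ultimately show ?thesis by (meson agree_sym agree_trans)
  qed
  then show ?thesis using b cn(1)[of "Suc p"]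
    by (intro exI[of _ "2 * c ^ Suc p + b"]) (auto intro: add_nonneg_nonneg less_imp_le)
qed

text \<open>Each inverse step costs \<open>\<sigma> / c\<close>, and later divisions by
  \<open>c\<close> shrink earlier losses. The geometric series sums to
  \<open>\<beta> * (1 - 1 / c ^ n)\<close>, hence a loss bounded independently of
  \<open>n\<close>.\<close>

lemma deflate_n:
  "\<exists>\<beta>\<ge>0. \<forall>n x y r. agree T ((f ^^ n) x) ((f ^^ n) y) r \<longrightarrow> agree T x y (r / c ^ n - \<beta>)"
proof -
  obtain \<sigma> where \<sigma>: "\<sigma> \<ge> 0" "\<And>x y. agree T (f x) (f y) \<sigma> \<Longrightarrow> agree T x y 0"
    using recognizable by blast
  have step: "agree T x y ((r - \<sigma>) / c)" if "agree T (f x) (f y) r" for x y r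
  proof (rule agree_local)
    fix w :: "real ^ 'n" assume w: "norm w \<le> (r - \<sigma>) / c"
    have "norm (f w) + \<sigma> \<le> r" using w c norm_n[of 1 w] by (simp add: field_simps)
    then have "agree T (f x + f w) (f y + f w) \<sigma>" using that agree_shift by blast
    then show "agree T (x + w) (y + w) 0" using \<sigma>(2) by (simp add: linear_add[OF lin])
  qed
  define \<beta> where "\<beta> = \<sigma> / (c - 1)"
  have \<beta>: "\<beta> \<ge> 0" "\<sigma> = \<beta> * (c - 1)" using \<sigma>(1) c by (auto simp: \<beta>_def)
  have "agree T x y (r / c ^ n - \<beta> * (1 - 1 / c ^ n))"
    if "agree T ((f ^^ n) x) ((f ^^ n) y) r" for n x y r
    using that
  proof (induction n arbitrary: r)
    case (Suc n)
    have "(r - \<sigma>) / c / c ^ n - \<beta> * (1 - 1 / c ^ n) = r / c ^ Suc n - \<beta> * (1 - 1 / c ^ Suc n)"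
      using c by (simp add: \<beta>(2) field_simps)
    then show ?case using Suc.IH[of "(r - \<sigma>) / c"] step Suc.prems by simp
  qed simp
  moreover have "r / c ^ n - \<beta> \<le> r / c ^ n - \<beta> * (1 - 1 / c ^ n)" for n and r :: real
    using \<beta>(1) cn(1)[of n] by (simp add: algebra_simps)
  ultimately show ?thesis using \<beta>(1) agree_mono by (intro exI[of _ \<beta>]) blast
qed

end

subsection \<open>Derived Voronoi tilings\<close>

lemma voronoi_cell_similitude:
  fixes f :: "real ^ 'n::finite \<Rightarrow> real ^ 'n"
  assumes "linear f" "\<And>x y. norm (f x - f y) = c * norm (x - y)" "c > 0"
  shows "voronoi_cell (f ` L) (f q) = f ` voronoi_cell L q"
proof -
  have *: "f x \<in> voronoi_cell (f ` L) (f q) \<longleftrightarrow> x \<in> voronoi_cell L q" for x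
    using assms(3) by (simp add: voronoi_cell_def assms(2))
  have "surj f" by (rule similitude_surj) (use assms in auto)
  show ?thesis
  proof (intro set_eqI iffI)
    fix y assume y: "y \<in> voronoi_cell (f ` L) (f q)"
    obtain x where "y = f x" using \<open>surj f\<close> by (rule surjE)
    then show "y \<in> f ` voronoi_cell L q" using y * by blast
  qed (use * in blast)
qed

text \<open>Labels of derived tilings at different radii are classes of different patches, so only
  the partitions they induce on a common index set can be compared.\<close>

lemma equal_up_to_labels_image:
  assumes "\<And>z w. z \<in> Z \<Longrightarrow> w \<in> Z \<Longrightarrow> a z = a w \<longleftrightarrow> a' z = a' w"
  shows "equal_up_to_labels ((\<lambda>z. (h z, a z)) ` Z) ((\<lambda>z. (h z, a' z)) ` Z)"
proof -
  define b where "b l = a' (SOME z. z \<in> Z \<and> a z = l)" for l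
  have b: "b (a z) = a' z" if "z \<in> Z" for z
  proof -
    have "(SOME w. w \<in> Z \<and> a w = a z) \<in> Z \<and> a (SOME w. w \<in> Z \<and> a w = a z) = a z"
      by (rule someI_ex) (use that in blast)
    then show ?thesis using assms that unfolding b_def by blast
  qed
  have "bij_betw b (a ` Z) (a' ` Z)"
    unfolding bij_betw_def inj_on_def using assms b by (auto simp: image_image intro!: image_cong)
  moreover have "(\<lambda>z. (h z, a' z)) ` Z = (\<lambda>t. (supp t, b (label t))) ` (\<lambda>z. (h z, a z)) ` Z"
    using b by (auto simp: image_image intro!: image_cong)
  moreover have "label ` (\<lambda>z. (h z, a z)) ` Z = a ` Z" "label ` (\<lambda>z. (h z, a' z)) ` Z = a' ` Z"
    by (simp_all add: image_image)
  ultimately show ?thesis unfolding equal_up_to_labels_def by (intro exI[of _ b]) metis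
qed

lemma equal_up_to_labels_supp: "equal_up_to_labels S S' \<Longrightarrow> supp ` S = supp ` S'"
  unfolding equal_up_to_labels_def by (elim exE conjE) (simp add: image_image)

lemma derived_voronoi_cong:
  "central_patch T r = central_patch T s \<Longrightarrow> derived_voronoi T r = derived_voronoi T s"
  by (simp add: derived_voronoi_def locators_def)

lemma locators_iff: "q \<in> locators T r \<longleftrightarrow> transl q (central_patch T r) \<subseteq> T"
proof
  assume "q \<in> locators T r"
  then show "transl q (central_patch T r) \<subseteq> T" by (auto simp: locators_def transl_add)
next
  assume "transl q (central_patch T r) \<subseteq> T"
  moreover have "central_patch T r = transl (- q) (transl q (central_patch T r))"
    by (simp add: transl_add)
  ultimately show "q \<in> locators T r" unfolding locators_def by blast
qed

lemma transl_central_patch: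
  assumes "q \<in> locators T r"
  shows "transl q (central_patch T r) \<subseteq> meeting T (cball q r)"
proof
  fix t assume t: "t \<in> transl q (central_patch T r)"
  then obtain u where u: "u \<in> meeting T (cball 0 r)" "t = tile_transl q u"
    by (auto simp: transl_def central_patch_def)
  have "tile_transl q u \<in> T" using t assms u(2) unfolding locators_iff by blast
  then show "t \<in> meeting T (cball q r)" using tile_transl_in_meeting_cball[OF u(1)] u(2) by simp
qed

lemma zero_locator: "0 \<in> locators T r"
  by (auto simp: locators_iff central_patch_def meeting_def)

lemma locator_agree:
  assumes "agree T q' q r" "q \<in> locators T r"
  shows "q' \<in> locators T r"
proof -
  have "transl q' (central_patch T r) = transl (q' - q) (transl q (central_patch T r))"
    by (simp add: transl_add)
  also have "\<dots> \<subseteq> transl (q' - q) (meeting T (cball q r))"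
    using transl_central_patch[OF assms(2)] unfolding transl_def by blast
  also have "\<dots> \<subseteq> T" using assms(1) by (auto simp: agree_iff transl_def)
  finally show ?thesis by (simp add: locators_iff)
qed

context flc_tiling
begin

lemma locator_agree_central:
  assumes "q \<in> locators T r" "r' < r"
  shows "agree T q 0 r'"
  using agree_of_transl_subset[of q 0 r r'] assms by (simp add: locators_iff central_patch_def)

lemma finite_locators: "r > 0 \<Longrightarrow> finite (locators T r \<inter> cball x s)"
proof (rule finite_subset[OF _ finite_agreeing_points[of "norm x + s"]])
  assume "r > 0"
  show "locators T r \<inter> cball x s \<subseteq> {u \<in> cball 0 (norm x + s). agree T u 0 0}"
  proof
    fix q assume q: "q \<in> locators T r \<inter> cball x s"
    then have "norm q \<le> norm x + s"
      using norm_triangle_sub[of q x] by (simp add: dist_norm norm_minus_commute)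
    moreover have "agree T q 0 0" using q \<open>r > 0\<close> locator_agree_central by blast
    ultimately show "q \<in> {u \<in> cball 0 (norm x + s). agree T u 0 0}" by simp
  qed
qed

text \<open>A nonzero displacement cannot agree with the origin at all radii, and only finitely many
  displacements of length at most \<open>M\<close> are candidates. Two locators that close would
  make their difference agree with 0 up to radius about \<open>r - M\<close>.\<close>

lemma locators_separated:
  assumes "nonperiodic T"
  shows "\<exists>r0. \<forall>r\<ge>r0. \<forall>q\<in>locators T r. \<forall>q'\<in>locators T r. q \<noteq> q' \<longrightarrow> M < dist q q'"
proof -
  define H where "H = {u \<in> cball 0 M. agree T u 0 0}"
  have "\<exists>\<rho>. \<not> agree T u 0 \<rho>" if "u \<noteq> 0" for u
  proof (rule ccontr)
    assume *: "\<nexists>\<rho>. \<not> agree T u 0 \<rho>"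
    have "agree T z (z + u) 0" for z
    proof -
      have "agree T (u + z) (0 + z) 0" by (rule agree_shift[of _ _ _ "norm z"]) (use * in auto)
      then show ?thesis by (simp add: agree_sym add.commute)
    qed
    then show False using nonperiodic_agree[OF assms] that by blast
  qed
  then obtain \<rho> where \<rho>: "\<And>u. u \<noteq> 0 \<Longrightarrow> \<not> agree T u 0 (\<rho> u)" by metis
  \<comment> \<open>The 1 covers the loss in \<open>locator_agree_central\<close>,
    \<open>\<bar>M\<bar>\<close> covers the shift by \<open>u\<close>, and the sum dominates each
    \<open>\<rho> u\<close>.\<close>
  define r0 where "r0 = \<bar>M\<bar> + 1 + (\<Sum>u\<in>H. \<bar>\<rho> u\<bar>)"
  have "M < dist q q'"
    if r: "r \<ge> r0" and q: "q \<in> locators T r" "q' \<in> locators T r" "q \<noteq> q'" for r q q'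
  proof (rule ccontr)
    assume le: "\<not> M < dist q q'"
    define u where "u = q' - q"
    have u: "norm u \<le> M" "u \<noteq> 0" using le q(3) by (auto simp: u_def dist_norm norm_minus_commute)
    have ag0: "agree T q 0 (r - 1)" "agree T q' 0 (r - 1)" using q locator_agree_central by auto
    have "agree T (q + u) (0 + u) (r - 1 - M)" by (rule agree_shift[OF ag0(1)]) (use u(1) in simp)
    moreover have "agree T q' 0 (r - 1 - M)"
      by (rule agree_mono[OF ag0(2)]) (use order_trans[OF norm_ge_zero u(1)] in simp)
    ultimately have ag: "agree T u 0 (r - 1 - M)" by (auto simp: u_def intro: agree_sym agree_trans)
    have sum: "(\<Sum>u\<in>H. \<bar>\<rho> u\<bar>) \<le> r - 1 - M" using r by (simp add: r0_def)
    have "0 \<le> (\<Sum>u\<in>H. \<bar>\<rho> u\<bar>)" by (intro sum_nonneg) simp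
    then have "0 \<le> r - 1 - M" using sum by linarith
    then have "u \<in> H" using u(1) agree_mono[OF ag] by (simp add: H_def)
    then have "\<bar>\<rho> u\<bar> \<le> (\<Sum>u\<in>H. \<bar>\<rho> u\<bar>)"
      using finite_agreeing_points by (intro member_le_sum) (auto simp: H_def)
    then have "agree T u 0 (\<rho> u)" using sum by (intro agree_mono[OF ag]) simp
    then show False using \<rho> u(2) by blast
  qed
  then show ?thesis by blast
qed

end

section \<open>Cells and labels of the derived tilings, and derivability in both directions\<close>

context rep_tiling
begin

definition central_radius where "central_radius r = rep_radius T (central_patch T r)"

definition cell where "cell r q = voronoi_cell (locators T r) q"

definition locator_class where
  "locator_class r q = transl_class (meeting T (cball q (2 * central_radius r)))"

lemma derived_voronoi_eq:
  "derived_voronoi T r = (\<lambda>q. (cell r q, locator_class r q)) ` locators T r"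
  by (simp add: derived_voronoi_def cell_def locator_class_def central_radius_def)

lemma central_radius:
  assumes "r > 0"
  shows "recurs_within T (central_patch T r) (central_radius r)"
    and "recurs_within T (central_patch T r) R \<Longrightarrow> central_radius r \<le> R"
proof -
  obtain R1 where "recurs_within T (central_patch T r) R1"
    using rep is_patch_meeting unfolding repetitive_def central_patch_def by blast
  note * = recurs_within_rep_radius[OF _ assms _ this, of 0 r 0]
  show "recurs_within T (central_patch T r) (central_radius r)"
    and "recurs_within T (central_patch T r) R \<Longrightarrow> central_radius r \<le> R"
    using * cball_subset_patch_supp by (auto simp: central_radius_def central_patch_def)
qed

text \<open>The recurring copy of the central patch contains the ball of radius \<open>r\<close>
  about its locator; this ball accounts for the summand \<open>r\<close>.\<close>

lemma near_locator:
  assumes "r > 0"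
  obtains q where "q \<in> locators T r" "dist x q + r \<le> central_radius r"
proof -
  obtain g where g: "transl g (central_patch T r) \<subseteq> T"
    "patch_supp (transl g (central_patch T r)) \<subseteq> cball x (central_radius r)"
    using central_radius(1)[OF assms] unfolding recurs_within_def is_patch_def by metis
  have "cball g r \<subseteq> patch_supp (transl g (central_patch T r))"
  proof
    fix p assume "p \<in> cball g r"
    then have "p - g \<in> cball 0 r" by (simp add: dist_norm norm_minus_commute)
    then have "p - g \<in> patch_supp (central_patch T r)"
      using cball_subset_patch_supp unfolding central_patch_def by blast
    then show "p \<in> patch_supp (transl g (central_patch T r))" unfolding patch_supp_transl by force
  qed
  then have "cball g r \<subseteq> cball x (central_radius r)" using g(2) by blast
  then have "dist x g + r \<le> central_radius r"
    using assms by (auto simp: cball_subset_cball_iff dist_commute)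
  then show thesis using g(1) that by (simp add: locators_iff)
qed

lemma central_radius_ge: "r > 0 \<Longrightarrow> r \<le> central_radius r"
  using near_locator[of r 0] zero_le_dist by (metis add_increasing order_refl order_trans)

lemma cell_radius:
  assumes "r > 0" "p \<in> cell r q"
  shows "dist q p + r \<le> central_radius r"
proof -
  obtain q' where "q' \<in> locators T r" "dist p q' + r \<le> central_radius r"
    by (rule near_locator[OF assms(1)])
  moreover from this have "dist q p \<le> dist p q'"
    using assms(2) by (auto simp: cell_def voronoi_cell_def dist_norm norm_minus_commute)
  ultimately show ?thesis by simp
qed

text \<open>A locator \<open>a\<close> that beats \<open>q'\<close> at a point of the moved cell
  lies so close to \<open>q'\<close> that its ball of radius \<open>r\<close> is inside the agreeing
  ball. Its translate is then a locator beating \<open>q\<close>. The label radius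
  \<open>2 * central_radius r\<close> is what this requires.\<close>

lemma cell_transfer:
  assumes "r > 0" "q \<in> locators T r" "agree T q q' (2 * central_radius r)"
  shows "cell r q = (\<lambda>x. x + (q - q')) ` cell r q'"
proof -
  have ge: "r \<le> 2 * central_radius r" using central_radius_ge[OF assms(1)] assms(1) by simp
  have *: "p - (q - q') \<in> cell r q'"
    if q: "q \<in> locators T r" and ag: "agree T q q' (2 * central_radius r)" and p: "p \<in> cell r q"
    for p q q'
    unfolding cell_def voronoi_cell_def
  proof (intro CollectI ballI, rule ccontr)
    fix a assume a: "a \<in> locators T r" and "\<not> norm (q' - (p - (q - q'))) \<le> norm (a - (p - (q - q')))"
    then have lt: "norm (a + (q - q') - p) < norm (q - p)" by (simp add: algebra_simps)
    also have qp: "norm (q - p) + r \<le> central_radius r"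
      using cell_radius[OF assms(1) p] by (simp add: dist_norm)
    finally have "norm (a + (q - q') - p) + norm (q - p) + 2 * r < 2 * central_radius r"
      using qp lt by linarith
    moreover have "norm (a - q') \<le> norm (a + (q - q') - p) + norm (q - p)"
      using norm_triangle_ineq4[of "a + (q - q') - p" "q - p"] by simp
    ultimately have "norm (a - q') + r \<le> 2 * central_radius r" using assms(1) by linarith
    then have "agree T (a + (q - q')) a r"
      by (intro agree_shift'[OF ag]) (simp_all add: algebra_simps)
    then have "a + (q - q') \<in> locators T r" using a by (rule locator_agree)
    then have "norm (q - p) \<le> norm (a + (q - q') - p)" using p by (auto simp: cell_def voronoi_cell_def)
    then show False using lt by simp
  qed
  have q': "q' \<in> locators T r" using assms(2,3) ge agree_mono agree_sym locator_agree by blast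
  show ?thesis
  proof (intro set_eqI iffI)
    fix p assume "p \<in> cell r q"
    then have "p - (q - q') \<in> cell r q'" using * assms by blast
    then show "p \<in> (\<lambda>x. x + (q - q')) ` cell r q'" by force
  next
    fix p assume "p \<in> (\<lambda>x. x + (q - q')) ` cell r q'"
    then obtain x where x: "x \<in> cell r q'" "p = x + (q - q')" by blast
    then have "x - (q' - q) \<in> cell r q" using *[OF q' agree_sym[OF assms(3)]] by blast
    moreover have "x - (q' - q) = p" using x(2) by simp
    ultimately show "p \<in> cell r q" by simp
  qed
qed

lemma in_some_cell:
  assumes "r > 0"
  obtains q where "q \<in> locators T r" "x \<in> cell r q"
proof -
  define A where "A = locators T r \<inter> cball x (central_radius r)"
  have fin: "finite A" unfolding A_def by (rule finite_locators[OF assms])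
  obtain q0 where q0: "q0 \<in> locators T r" "dist x q0 + r \<le> central_radius r"
    by (rule near_locator[OF assms])
  then have "A \<noteq> {}" using assms by (auto simp: A_def)
  then obtain q where q: "q \<in> A" "\<And>a. a \<in> A \<Longrightarrow> dist x q \<le> dist x a"
    using fin by (smt (verit) arg_min_if_finite(1) arg_min_least)
  have "dist x q \<le> dist x a" if a: "a \<in> locators T r" for a
    using a q by (cases "dist x a \<le> central_radius r") (auto simp: A_def)
  then have "x \<in> cell r q"
    by (simp add: cell_def voronoi_cell_def dist_norm norm_minus_commute)
  then show thesis using q(1) by (intro that[of q]) (simp_all add: A_def)
qed

text \<open>The locator of a cell containing \<open>y\<close> is within
  \<open>central_radius r\<close> of \<open>y\<close>, and its cell and label are determined by the
  ball of twice that radius about it. The radius 4 covers both.\<close>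

lemma derived_voronoi_agree:
  assumes r: "r > 0" and ag: "agree T x y (4 * central_radius r)"
  shows "agree (derived_voronoi T r) x y 0"
proof -
  have R: "central_radius r \<ge> r" "central_radius r > 0" using central_radius_ge[OF r] r by auto
  have *: "tile_transl (x - y) t \<in> derived_voronoi T r"
    if ag: "agree T x y (4 * central_radius r)" and t: "t \<in> meeting (derived_voronoi T r) (cball y 0)"
    for x y t
  proof -
    obtain q where q: "q \<in> locators T r" "t = (cell r q, locator_class r q)" "y \<in> cell r q"
      using t by (auto simp: derived_voronoi_eq meeting_def)
    define q' where "q' = q + (x - y)"
    have d: "dist q y \<le> central_radius r" using cell_radius[OF r q(3)] r by simp
    have "agree T q' q (2 * central_radius r)"
      by (rule agree_shift'[OF ag]) (use d R in \<open>auto simp: q'_def dist_norm\<close>)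
    moreover have q': "q' \<in> locators T r"
      by (rule locator_agree[OF agree_mono[OF calculation] q(1)]) (use R in simp)
    ultimately have "cell r q' = (\<lambda>p. p + (x - y)) ` cell r q" "locator_class r q = locator_class r q'"
      using cell_transfer[OF r, of q' q] unfolding agree_def locator_class_def transl_class_eq_iff
      by (auto simp: q'_def)
    then have "tile_transl (x - y) t = (cell r q', locator_class r q')"
      using q(2) by (simp add: tile_transl_def)
    then show ?thesis using q' by (auto simp: derived_voronoi_eq)
  qed
  show ?thesis unfolding agree_iff using *[OF ag] *[OF agree_sym[OF ag]] by blast
qed

text \<open>A label of the derived tiling is a patch up to translation only.  When locators are further
  apart than the diameter of any tile, the position of that patch relative to the locator can be
  recovered.\<close>

lemma agree_of_derived_voronoi:
  assumes r: "r > 0"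
    and D: "\<forall>t\<in>T. \<forall>x\<in>supp t. \<forall>y\<in>supp t. dist x y \<le> D"
    and sep: "\<forall>q\<in>locators T r. \<forall>q'\<in>locators T r. q \<noteq> q' \<longrightarrow> D < dist q q'"
    and ag: "agree (derived_voronoi T r) x y 0"
  shows "agree T x y 0"
proof -
  define R where "R = central_radius r"
  have R: "R \<ge> r" "R > 0" using central_radius_ge[OF r] r by (auto simp: R_def)
  obtain q where q: "q \<in> locators T r" "x \<in> cell r q" by (rule in_some_cell[OF r])
  have "(cell r q, locator_class r q) \<in> meeting (derived_voronoi T r) (cball x 0)"
    using q by (auto simp: derived_voronoi_eq meeting_def)
  then have "tile_transl (y - x) (cell r q, locator_class r q) \<in> derived_voronoi T r"
    using ag unfolding agree_iff by blast
  then obtain q' where q': "q' \<in> locators T r" "cell r q' = (\<lambda>p. p + (y - x)) ` cell r q"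
    "locator_class r q = locator_class r q'"
    by (auto simp: derived_voronoi_eq tile_transl_def)
  obtain g where g: "meeting T (cball q' (2 * R)) = transl g (meeting T (cball q (2 * R)))"
    using q'(3) by (auto simp: locator_class_def transl_class_eq_iff R_def)
  \<comment> \<open>The translation that matches the two labelling patches carries \<open>q\<close>
    to \<open>w\<close>. Since the central patch travels along, \<open>w\<close> is a locator, and
    separation will force it to equal \<open>q'\<close>.\<close>
  define w where "w = q + g"
  have "transl q (central_patch T r) \<subseteq> meeting T (cball q (2 * R))"
    using transl_central_patch[OF q(1)] meeting_cball_mono[of q q r "2 * R" T] R by auto
  then have "transl g (transl q (central_patch T r)) \<subseteq> meeting T (cball q' (2 * R))"
    unfolding g by (auto simp: transl_def)
  then have w: "w \<in> locators T r" by (auto simp: locators_iff w_def transl_add meeting_def)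
  have "w = q'"
  proof (rule ccontr)
    assume "w \<noteq> q'"
    then have far: "D < norm (w - q')" using sep w q'(1) by (simp add: dist_norm)
    \<comment> \<open>The point of the ball of radius \<open>2 * R\<close> about \<open>w\<close>
      farthest from \<open>q'\<close>. It lies in the translated patch, yet at distance more than
      \<open>2 * R + D\<close> from \<open>q'\<close>.\<close>
    define e where "e = w + (2 * R / norm (w - q')) *\<^sub>R (w - q')"
    have pos: "norm (w - q') > 0" using \<open>w \<noteq> q'\<close> by simp
    have "e - g \<in> cball q (2 * R)" using pos R by (simp add: e_def w_def dist_norm)
    then have "e - g \<in> patch_supp (meeting T (cball q (2 * R)))" using cball_subset_patch_supp by blast
    then have "e \<in> patch_supp (meeting T (cball q' (2 * R)))" unfolding g patch_supp_transl by force
    then have "dist q' e \<le> 2 * R + D" by (rule meeting_extent[OF D])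
    moreover have "norm (e - q') = norm (w - q') + 2 * R"
    proof -
      have "e - q' = (1 + 2 * R / norm (w - q')) *\<^sub>R (w - q')"
        by (simp add: e_def algebra_simps)
      moreover have "\<bar>1 + 2 * R / norm (w - q')\<bar> = 1 + 2 * R / norm (w - q')"
        using R by (intro abs_of_nonneg add_nonneg_nonneg divide_nonneg_nonneg) auto
      ultimately show ?thesis using pos by (simp add: distrib_right)
    qed
    ultimately show False using far by (simp add: dist_norm norm_minus_commute)
  qed
  then have "g = q' - q" unfolding w_def by (metis add_diff_cancel_left')
  then have qq: "agree T q' q (2 * R)" using g by (simp only: agree_def)
  have "dist q p \<le> R" if "p \<in> cell r q" for p using cell_radius[OF r that] r by (simp add: R_def)
  then have "bounded (cell r q)" unfolding bounded_def by blast
  \<comment> \<open>The cell is moved to the same set by the locator displacement and by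
    \<open>y - x\<close>; being bounded and nonempty, it determines the vector.\<close>
  moreover have "(\<lambda>p. p + (q' - q)) ` cell r q = (\<lambda>p. p + (y - x)) ` cell r q"
    using cell_transfer[OF r q'(1)] qq q'(2) by (simp add: R_def)
  ultimately have eq: "q' - q = y - x" using q(2) bounded_translate_eqD by blast
  have "dist q x \<le> R" using cell_radius[OF r q(2)] r by (simp add: R_def)
  moreover have "y - q' = x - q" using eq by (simp add: algebra_simps)
  ultimately have "agree T y x 0"
    using R by (intro agree_shift'[OF qq]) (simp_all add: dist_commute flip: dist_norm)
  then show ?thesis by (rule agree_sym)
qed

section \<open>From finiteness of the derived family to pseudo-self-similarity\<close>

lemma pseudo_self_similar_if_finite_under:
  assumes np: "nonperiodic T" and ex: "expanding_similitude \<psi>"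
    and fin: "finite_under \<psi> (derived_voronoi_family T)"
  shows "pseudo_self_similar T"
proof -
  obtain c where lin: "linear \<psi>" and c: "c > 1" and sim: "\<And>x y. norm (\<psi> x - \<psi> y) = c * norm (x - y)"
    using ex unfolding expanding_similitude_def by blast
  note lin_n = funpow_similitude(1)[OF lin sim] and sim_n = funpow_similitude(2)[OF lin sim]
  have cn: "c ^ n > 0" for n using c by simp
  have agree_map: "agree (map_tiling (\<psi> ^^ n) S) ((\<psi> ^^ n) x) ((\<psi> ^^ n) y) (c ^ n * r) \<longleftrightarrow> agree S x y r"
    for n x y r and S :: "('n, 'k) tile set"
    by (rule agree_map_tiling[OF lin_n sim_n cn])
  have surj: "\<exists>x'. x = (\<psi> ^^ n) x'" for n x
    using similitude_surj[OF lin_n sim_n cn, of n] by (rule surjD)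
  obtain D where D: "D > 0" "\<forall>t\<in>T. \<forall>x\<in>supp t. \<forall>y\<in>supp t. dist x y \<le> D"
    using tile_diameter_bound by blast
  obtain r0 where r0: "\<forall>r\<ge>r0. \<forall>q\<in>locators T r. \<forall>q'\<in>locators T r. q \<noteq> q' \<longrightarrow> D < dist q q'"
    using locators_separated[OF np] by blast
  obtain \<G> :: "('n, ('n, 'l) tile set set) tile set set" where \<G>: "finite \<G>"
    "\<forall>S\<in>derived_voronoi_family T. \<exists>S'\<in>\<G>. \<exists>j. equal_up_to_labels S (map_tiling (\<psi> ^^ j) S')"
    using fin unfolding finite_under_def by blast
  define d where "d n = derived_voronoi T (real (Suc n))" for n
  have "\<forall>n. \<exists>S j. S \<in> \<G> \<and> equal_up_to_labels (d n) (map_tiling (\<psi> ^^ j) S)"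
  proof
    fix n
    have "d n \<in> derived_voronoi_family T"
      unfolding d_def derived_voronoi_family_def using of_nat_0_less_iff zero_less_Suc by blast
    then show "\<exists>S j. S \<in> \<G> \<and> equal_up_to_labels (d n) (map_tiling (\<psi> ^^ j) S)" using \<G>(2) by blast
  qed
  then obtain S j where S: "\<And>n. S n \<in> \<G>" and j: "\<And>n. equal_up_to_labels (d n) (map_tiling (\<psi> ^^ j n) (S n))"
    by metis
  have "finite (range S)" by (rule finite_subset[OF _ \<G>(1)]) (use S in blast)
  then obtain m where m: "infinite {n. S n = S m}"
    using pigeonhole_infinite[of UNIV S] by auto
  have large: "\<exists>n. x \<le> real (Suc n) \<and> S n = S m" for x
  proof -
    obtain k where "x \<le> real k" using real_arch_simple by blast
    moreover obtain n where "n > k" "S n = S m" using m by (auto simp: infinite_nat_iff_unbounded)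
    ultimately show ?thesis by (intro exI[of _ n]) simp
  qed
  obtain n1 where n1: "S n1 = S m" by blast
  define R1 where "R1 = central_radius (real (Suc n1))"
  have R1: "R1 > 0" using central_radius_ge[of "real (Suc n1)"] by (simp add: R1_def)
  \<comment> \<open>At this separation the cell of 0 has points at distance
    \<open>2 * R1 + 1\<close>, whereas cells of \<open>d n1\<close> have diameter at most
    \<open>2 * R1\<close>. Both tilings are scalings of \<open>S m\<close>, so the second exponent
    must be larger.\<close>
  obtain r1 where r1: "\<forall>r\<ge>r1. \<forall>q\<in>locators T r. \<forall>q'\<in>locators T r. q \<noteq> q' \<longrightarrow> 4 * R1 + 2 < dist q q'"
    using locators_separated[OF np] by blast
  obtain n2 where n2: "max r0 r1 \<le> real (Suc n2)" "S n2 = S m" using large by blast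
  have "j n1 < j n2"
  proof (rule ccontr)
    assume "\<not> j n1 < j n2"
    then have le: "c ^ j n2 \<le> c ^ j n1" using c by (intro power_increasing) auto
    obtain e :: "real ^ 'n" where e: "norm e = 2 * R1 + 1"
      using vector_choose_size[of "2 * R1 + 1"] R1 by auto
    have "norm (0 - y) \<le> norm (q - y)" if y: "y = 0 \<or> y = e" and q: "q \<in> locators T (real (Suc n2))" for q y
    proof (cases "q = 0")
      case False
      then have "4 * R1 + 2 < norm q" using r1 n2(1) q zero_locator[of T] by fastforce
      then show ?thesis using y e norm_triangle_sub[of q e] by auto
    qed simp
    then have "{0, e} \<subseteq> cell (real (Suc n2)) 0" by (auto simp: cell_def voronoi_cell_def)
    moreover have "cell (real (Suc n2)) 0 \<in> supp ` d n2"
      using zero_locator by (auto simp: d_def derived_voronoi_eq image_image)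
    moreover have "supp ` d n2 = (\<lambda>t. (\<psi> ^^ j n2) ` supp t) ` S m"
      using equal_up_to_labels_supp[OF j[of n2]] by (simp add: map_tiling_def image_image n2(2))
    ultimately obtain t where t: "t \<in> S m" "{0, e} \<subseteq> (\<psi> ^^ j n2) ` supp t" by auto
    then obtain u v where uv: "u \<in> supp t" "v \<in> supp t" "(\<psi> ^^ j n2) u = 0" "(\<psi> ^^ j n2) v = e" by auto
    have "supp ` d n1 = (\<lambda>t. (\<psi> ^^ j n1) ` supp t) ` S m"
      using equal_up_to_labels_supp[OF j[of n1]] by (simp add: map_tiling_def image_image n1)
    then have "(\<psi> ^^ j n1) ` supp t \<in> supp ` d n1" using t(1) by blast
    then obtain q where q: "(\<psi> ^^ j n1) ` supp t = cell (real (Suc n1)) q"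
      by (auto simp: d_def derived_voronoi_eq)
    have near: "dist q ((\<psi> ^^ j n1) a) \<le> R1" if "a \<in> supp t" for a
    proof -
      have "(\<psi> ^^ j n1) a \<in> cell (real (Suc n1)) q" using q that by blast
      then show ?thesis using cell_radius[of "real (Suc n1)"] by (fastforce simp: R1_def)
    qed
    have "2 * R1 + 1 = c ^ j n2 * norm (v - u)" using e uv(3,4) sim_n[of "j n2" v u] by simp
    also have "\<dots> \<le> c ^ j n1 * norm (v - u)" using le by (intro mult_right_mono) auto
    also have "\<dots> = dist ((\<psi> ^^ j n1) v) ((\<psi> ^^ j n1) u)" by (simp add: sim_n dist_norm)
    also have "\<dots> \<le> 2 * R1"
      using near[OF uv(1)] near[OF uv(2)] dist_triangle3[of "(\<psi> ^^ j n1) v" "(\<psi> ^^ j n1) u" q] by simp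
    finally show False by simp
  qed
  then obtain k where k: "j n2 = k + j n1" "k > 0" by (metis add.commute less_imp_add_positive)
  \<comment> \<open>Agreement passes from \<open>T\<close> at \<open>x'\<close> to
    \<open>d n1\<close>, down to \<open>S m\<close> at \<open>x''\<close>, up to \<open>d n2\<close>
    at \<open>x\<close>, and back to \<open>T\<close>. The exponents of descent and ascent differ by
    \<open>k\<close>.\<close>
  have "agree T x y 0" if xy: "agree (map_tiling (\<psi> ^^ k) T) x y (c ^ k * (4 * R1))" for x y
  proof -
    obtain x' y' where x': "x = (\<psi> ^^ k) x'" and y': "y = (\<psi> ^^ k) y'" using surj by metis
    obtain x'' y'' where x'': "x' = (\<psi> ^^ j n1) x''" and y'': "y' = (\<psi> ^^ j n1) y''" using surj by metis
    have "agree T x' y' (4 * R1)" using xy by (simp add: x' y' agree_map)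
    then have "agree (d n1) x' y' 0" unfolding d_def R1_def by (rule derived_voronoi_agree[rotated]) simp
    then have "agree (map_tiling (\<psi> ^^ j n1) (S m)) x' y' (c ^ j n1 * 0)"
      using agree_relabel[OF j[of n1]] by (simp add: n1)
    then have "agree (S m) x'' y'' 0" unfolding x'' y'' agree_map .
    then have "agree (map_tiling (\<psi> ^^ j n2) (S m)) ((\<psi> ^^ j n2) x'') ((\<psi> ^^ j n2) y'') (c ^ j n2 * 0)"
      unfolding agree_map .
    then have "agree (map_tiling (\<psi> ^^ j n2) (S n2)) x y 0"
      by (simp add: n2(2) x' y' x'' y'' k(1) funpow_add)
    then have "agree (d n2) x y 0" using agree_relabel[OF equal_up_to_labels_sym[OF j[of n2]]] by blast
    then show ?thesis
      using r0 n2(1) unfolding d_def by (intro agree_of_derived_voronoi[OF _ D(2)]) auto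
  qed
  moreover have "c ^ k * (4 * R1) > 0" using cn[of k] R1 by simp
  ultimately have "locally_derivable T (map_tiling (\<psi> ^^ k) T)"
    unfolding locally_derivable_agree by blast
  moreover have "expanding_similitude (\<psi> ^^ k)"
    unfolding expanding_similitude_def using lin_n sim_n one_less_power[OF c k(2)] by blast
  ultimately show ?thesis
    unfolding pseudo_self_similar_def using tiling flc rep by blast
qed

end

section \<open>From pseudo-self-similarity to finiteness of the derived family\<close>

context inflated_tiling
begin

lemma central_radius_linear: "\<exists>C\<ge>1. \<forall>s\<ge>1. central_radius s \<le> C * s"
proof -
  obtain C where C: "C > 0" "\<And>s z x. s \<ge> 1 \<Longrightarrow> \<exists>y. dist x y \<le> C * s \<and> agree T z y s"
    using linearly_repetitive by blast
  obtain D where D: "D > 0" "\<forall>t\<in>T. \<forall>x\<in>supp t. \<forall>y\<in>supp t. dist x y \<le> D"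
    using tile_diameter_bound by blast
  have "central_radius s \<le> (C + 1 + D) * s" if s: "s \<ge> 1" for s
  proof (rule central_radius(2))
    show "recurs_within T (central_patch T s) ((C + 1 + D) * s)"
      unfolding recurs_within_def
    proof (intro conjI allI)
      show "0 < (C + 1 + D) * s" using C(1) D(1) s by simp
      fix x
      obtain y where y: "dist x y \<le> C * s" "agree T 0 y s" using C(2)[OF s] by blast
      have eq: "meeting T (cball y s) = transl y (central_patch T s)"
        using agree_sym[OF y(2)] by (simp add: agree_def central_patch_def)
      have "dist x p \<le> (C + 1 + D) * s" if p: "p \<in> patch_supp (meeting T (cball y s))" for p
      proof -
        have "dist x p \<le> C * s + (s + D)"
          using y(1) meeting_extent[OF D(2) p] dist_triangle[of x p y] by simp
        also have "\<dots> \<le> (C + 1 + D) * s" using D(1) s by (simp add: algebra_simps)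
        finally show ?thesis .
      qed
      then show "\<exists>P'. is_patch T P' \<and> (\<exists>g. P' = transl g (central_patch T s)) \<and>
          patch_supp P' \<subseteq> cball x ((C + 1 + D) * s)"
        using is_patch_meeting[of y s] by (intro exI[of _ "meeting T (cball y s)"]) (auto simp: eq)
    qed
  qed (use s in simp)
  then show ?thesis using C(1) D(1) by (intro exI[of _ "C + 1 + D"]) auto
qed

text \<open>Pull the locators of radius \<open>s\<close> back by \<open>f\<^sup>j\<close> with \<open>c\<^sup>j\<close> comparable to \<open>s\<close>.  The resulting set,
  together with the partition by labels, is determined by its trace on a fixed ball, which is
  contained in a fixed finite set.\<close>

lemma finite_under_derived_voronoi_family: "finite_under f (derived_voronoi_family T)"
proof -
  obtain \<beta> where \<beta>: "\<beta> \<ge> 0"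
    "\<And>n x y r. agree T ((f ^^ n) x) ((f ^^ n) y) r \<Longrightarrow> agree T x y (r / c ^ n - \<beta>)"
    using deflate_n by blast
  obtain C where C: "C \<ge> 1" "\<And>s. s \<ge> 1 \<Longrightarrow> central_radius s \<le> C * s"
    using central_radius_linear by blast
  \<comment> \<open>With \<open>s \<ge> K * c ^ j s\<close>, agreement of radius just below
    \<open>s\<close> still has nonnegative radius after deflation by \<open>j s\<close>
    steps.\<close>
  define K where "K = \<beta> + 1"
  have K: "K \<ge> 1" using \<beta>(1) by (simp add: K_def)
  define j where "j s = (SOME n. c ^ n \<le> s / K \<and> s / K < c ^ Suc n)" for s
  have j: "K * c ^ j s \<le> s" "s \<le> K * c * c ^ j s" if "s \<ge> K" for s
  proof -
    have "s / K \<ge> 1" using that K by simp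
    from someI_ex[OF ex_power_between[OF c this]]
    show "K * c ^ j s \<le> s" "s \<le> K * c * c ^ j s" using K by (auto simp: j_def field_simps)
  qed
  \<comment> \<open>Inflating radius \<open>M\<close> by \<open>j s\<close> steps yields at least
    \<open>2 * C * K * c * c ^ j s\<close>, hence at least the label radius
    \<open>2 * central_radius s\<close>.\<close>
  define M where "M = b + 2 * C * K * c"
  obtain G where G: "\<And>z x. \<exists>y. dist x y \<le> G \<and> agree T z y M" using uniformly_repetitive by blast
  define H where "H = {u \<in> cball 0 G. agree T u 0 0}"
  define Z where "Z s = {z. (f ^^ j s) z \<in> locators T s}" for s
  define a where "a s z = locator_class s ((f ^^ j s) z)" for s z
  \<comment> \<open>Only coincidences of labels are recorded; unlike the labels, these pairs range
    over a finite set independent of \<open>s\<close>.\<close>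
  define Q where
    "Q s = {(u, v). u \<in> Z s \<inter> cball 0 G \<and> v \<in> Z s \<inter> cball 0 G \<and> a s u = a s v}" for s
  define data where "data s = (Z s \<inter> cball 0 G, Q s)" for s
  have ZH: "Z s \<inter> cball 0 G \<subseteq> H" if s: "s \<ge> K" for s
  proof
    fix z assume z: "z \<in> Z s \<inter> cball 0 G"
    then have "agree T ((f ^^ j s) z) 0 (s - 1 / 2)"
      by (intro locator_agree_central[where r = s]) (simp_all add: Z_def)
    then have "agree T ((f ^^ j s) z) ((f ^^ j s) 0) (s - 1 / 2)" by (simp add: linear_0[OF lin_n])
    then have "agree T z 0 ((s - 1 / 2) / c ^ j s - \<beta>)" by (rule \<beta>(2))
    moreover have "(\<beta> + 1) * c ^ j s \<le> s" "c ^ j s \<ge> 1" using j(1)[OF s] cn by (auto simp: K_def)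
    then have "0 \<le> (s - 1 / 2) / c ^ j s - \<beta>" by (simp add: field_simps)
    ultimately show "z \<in> H" using z agree_mono unfolding H_def by blast
  qed
  have inv: "z \<in> Z s \<longleftrightarrow> u \<in> Z s" "a s z = a s u" if s: "s \<ge> K" and ag: "agree T z u M" for s z u
  proof -
    have "s \<ge> 1" using s K by simp
    have "2 * central_radius s \<le> 2 * C * s" using C(2)[OF \<open>s \<ge> 1\<close>] by simp
    also have "\<dots> \<le> 2 * C * (K * c * c ^ j s)" using j(2)[OF s] C(1) by (intro mult_left_mono) auto
    also have "\<dots> \<le> c ^ j s * (M - b) + b" using b by (simp add: M_def algebra_simps)
    finally have ag2: "agree T ((f ^^ j s) z) ((f ^^ j s) u) (2 * central_radius s)"
      using inflate_n[OF ag] agree_mono by blast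
    then have "agree T ((f ^^ j s) z) ((f ^^ j s) u) s"
      by (rule agree_mono) (use central_radius_ge[of s] \<open>s \<ge> 1\<close> in simp)
    then show "z \<in> Z s \<longleftrightarrow> u \<in> Z s" unfolding Z_def using locator_agree agree_sym by blast
    show "a s z = a s u"
      using agree_sym[OF ag2] unfolding a_def locator_class_def transl_class_eq_iff agree_def by blast
  qed
  have key: "equal_up_to_labels (derived_voronoi T s)
      (map_tiling (f ^^ (j s - j s')) (derived_voronoi T s'))"
    if s: "s \<ge> K" "s' \<ge> K" and eq: "data s = data s'" and le: "j s' \<le> j s" for s s'
  proof -
    \<comment> \<open>Every point has an agreeing representative in the fixed ball. Membership in
      \<open>Z s\<close> and the label are preserved, so the trace determines everything.\<close>
    obtain \<pi> where \<pi>: "\<And>z. \<pi> z \<in> cball 0 G" "\<And>z. agree T z (\<pi> z) M"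
      using G[of 0] by (metis mem_cball)
    have trace: "Z s \<inter> cball 0 G = Z s' \<inter> cball 0 G" and "Q s = Q s'"
      using eq by (simp_all only: data_def prod.inject)
    then have rel: "a s u = a s v \<longleftrightarrow> a s' u = a s' v"
      if "u \<in> Z s \<inter> cball 0 G" "v \<in> Z s \<inter> cball 0 G" for u v
    proof -
      have "(u, v) \<in> Q s \<longleftrightarrow> (u, v) \<in> Q s'" using \<open>Q s = Q s'\<close> by simp
      then show ?thesis using that trace unfolding Q_def by blast
    qed
    have Z: "Z s = Z s'"
    proof (intro set_eqI)
      fix z
      have "z \<in> Z s \<longleftrightarrow> \<pi> z \<in> Z s \<inter> cball 0 G" using inv(1)[OF s(1) \<pi>(2)] \<pi>(1) by blast
      also have "\<dots> \<longleftrightarrow> z \<in> Z s'" unfolding trace using inv(1)[OF s(2) \<pi>(2)] \<pi>(1) by blast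
      finally show "z \<in> Z s \<longleftrightarrow> z \<in> Z s'" .
    qed
    have rel': "a s z = a s w \<longleftrightarrow> a s' z = a s' w" if "z \<in> Z s" "w \<in> Z s" for z w
    proof -
      have "\<pi> z \<in> Z s \<inter> cball 0 G" "\<pi> w \<in> Z s \<inter> cball 0 G"
        using that inv(1)[OF s(1) \<pi>(2)] \<pi>(1) by blast+
      from rel[OF this] show ?thesis
        using inv(2)[OF s(1) \<pi>(2), of z] inv(2)[OF s(1) \<pi>(2), of w]
          inv(2)[OF s(2) \<pi>(2), of z] inv(2)[OF s(2) \<pi>(2), of w] by simp
    qed
    have dv: "derived_voronoi T s = (\<lambda>z. ((f ^^ j s) ` voronoi_cell (Z s) z, a s z)) ` Z s" for s
    proof -
      have L: "locators T s = (f ^^ j s) ` Z s"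
        using surj_image_vimage_eq[OF surj_n, of "j s" "locators T s"] by (simp add: Z_def vimage_def)
      have "cell s ((f ^^ j s) z) = (f ^^ j s) ` voronoi_cell (Z s) z" for z
        unfolding cell_def L by (rule voronoi_cell_similitude[OF lin_n sim_n cn(1)])
      then show ?thesis unfolding derived_voronoi_eq by (subst L) (simp add: image_image a_def)
    qed
    have comp: "(f ^^ (j s - j s')) ` (f ^^ j s') ` A = (f ^^ j s) ` A" for A
      using le by (simp add: image_comp flip: funpow_add)
    have "map_tiling (f ^^ (j s - j s')) (derived_voronoi T s') =
        (\<lambda>z. ((f ^^ j s) ` voronoi_cell (Z s) z, a s' z)) ` Z s"
      unfolding dv[of s'] map_tiling_def by (simp add: image_image Z comp[unfolded image_image])
    then show ?thesis unfolding dv[of s] using rel' by (simp add: equal_up_to_labels_image)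
  qed
  have "data ` {K..} \<subseteq> Pow H \<times> Pow (H \<times> H)" using ZH by (fastforce simp: data_def Q_def)
  moreover have "finite H" unfolding H_def by (rule finite_agreeing_points)
  ultimately have finD: "finite (data ` {K..})" by (meson finite_Pow_iff finite_SigmaI finite_subset)
  \<comment> \<open>The representative of each value of \<open>data\<close> has least
    \<open>j\<close>, so that every exponent difference is a genuine natural number.\<close>
  have "\<exists>s'. s' \<ge> K \<and> data s' = data s \<and> (\<forall>t. t \<ge> K \<and> data t = data s \<longrightarrow> j s' \<le> j t)" if "s \<ge> K" for s
    using ex_has_least_nat[of "\<lambda>t. t \<ge> K \<and> data t = data s" s j] that by blast
  then have "\<forall>d\<in>data ` {K..}. \<exists>s'. s' \<ge> K \<and> data s' = d \<and> (\<forall>t. t \<ge> K \<and> data t = d \<longrightarrow> j s' \<le> j t)"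
    by auto
  then obtain \<sigma> where \<sigma>: "\<And>d. d \<in> data ` {K..} \<Longrightarrow>
      \<sigma> d \<ge> K \<and> data (\<sigma> d) = d \<and> (\<forall>t. t \<ge> K \<and> data t = d \<longrightarrow> j (\<sigma> d) \<le> j t)"
    by metis
  define G1 where "G1 = derived_voronoi T ` \<sigma> ` data ` {K..}"
  \<comment> \<open>Radii below \<open>K\<close> are listed separately: the derived tiling depends
    only on the central patch, of which finitely many occur.\<close>
  define G2 where "G2 = derived_voronoi T ` {0<..<K}"
  have "finite G2"
  proof -
    define rep where "rep P = (SOME s. s \<in> {0<..<K} \<and> central_patch T s = P)" for P
    have "central_patch T ` {0<..<K} \<subseteq> Pow (meeting T (cball 0 K))"
    proof (intro image_subsetI PowI)
      fix s assume "s \<in> {0<..<K}"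
      then show "central_patch T s \<subseteq> meeting T (cball 0 K)"
        unfolding central_patch_def by (intro meeting_cball_mono) auto
    qed
    then have fin: "finite (central_patch T ` {0<..<K})"
      by (rule finite_subset) (simp add: finite_meeting)
    have "derived_voronoi T s = derived_voronoi T (rep (central_patch T s))" if "s \<in> {0<..<K}" for s
    proof -
      have "rep (central_patch T s) \<in> {0<..<K} \<and> central_patch T (rep (central_patch T s)) = central_patch T s"
        unfolding rep_def by (rule someI_ex) (use that in blast)
      then show ?thesis by (intro derived_voronoi_cong) simp
    qed
    then have "G2 \<subseteq> (\<lambda>P. derived_voronoi T (rep P)) ` central_patch T ` {0<..<K}"
      unfolding G2_def by auto
    then show ?thesis using fin by (meson finite_imageI finite_subset)
  qed
  then have "finite (G1 \<union> G2)" unfolding G1_def using finD by simp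
  moreover have "G1 \<union> G2 \<subseteq> derived_voronoi_family T"
    using \<sigma> K unfolding G1_def G2_def derived_voronoi_family_def by fastforce
  moreover have "\<forall>S\<in>derived_voronoi_family T.
      \<exists>S'\<in>G1 \<union> G2. \<exists>n. equal_up_to_labels S (map_tiling (f ^^ n) S')"
  proof
    fix S assume S: "S \<in> derived_voronoi_family T"
    obtain s where s: "S = derived_voronoi T s" "s > 0"
      using S by (auto simp: derived_voronoi_family_def)
    show "\<exists>S'\<in>G1 \<union> G2. \<exists>n. equal_up_to_labels S (map_tiling (f ^^ n) S')"
    proof (cases "s < K")
      case True
      have "map_tiling (f ^^ 0) S = S" by (simp add: map_tiling_def)
      then have "equal_up_to_labels S (map_tiling (f ^^ 0) S)" by simp
      moreover have "S \<in> G1 \<union> G2" using True s by (simp add: G2_def)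
      ultimately show ?thesis by blast
    next
      case False
      then have d: "data s \<in> data ` {K..}" "s \<ge> K" by auto
      have "equal_up_to_labels S
          (map_tiling (f ^^ (j s - j (\<sigma> (data s)))) (derived_voronoi T (\<sigma> (data s))))"
        unfolding s(1) using \<sigma>[OF d(1)] d(2) by (intro key) auto
      moreover have "derived_voronoi T (\<sigma> (data s)) \<in> G1 \<union> G2" using d(1) by (simp add: G1_def)
      ultimately show ?thesis by blast
    qed
  qed
  ultimately show ?thesis unfolding finite_under_def by (intro exI[of _ "G1 \<union> G2"] conjI)
qed

end

lemma finite_under_if_pseudo_self_similar:
  assumes "nonperiodic T" "pseudo_self_similar T"
  shows "\<exists>\<psi>. expanding_similitude \<psi> \<and> orientation_preserving \<psi> \<and>
    finite_under \<psi> (derived_voronoi_family T)"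
proof -
  obtain f where T: "is_tiling T" "FLC T" "repetitive T"
    and f: "expanding_similitude f" "locally_derivable T (map_tiling f T)"
    using assms(2) unfolding pseudo_self_similar_def by blast
  obtain c where lin: "linear f" and c: "c > 1" and sim: "\<And>x y. norm (f x - f y) = c * norm (x - y)"
    using f(1) unfolding expanding_similitude_def by blast
  obtain R where R: "R > 0" "\<And>x y. agree (map_tiling f T) x y R \<Longrightarrow> agree T x y 0"
    using f(2) unfolding locally_derivable_agree by blast
  have inflate: "agree T (f x) (f y) (c * r - R)" if "agree T x y r" for x y r
  proof (rule agree_of_local_rule[OF R(2)])
    show "agree (map_tiling f T) (f x) (f y) (R + (c * r - R))"
      using agree_map_tiling[OF lin sim, of T x y r] that c by simp
  qed
  \<comment> \<open>\<open>f\<close> may reverse orientation; the determinant of its square is the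
    square of a nonzero number.\<close>
  define \<psi> where "\<psi> = f \<circ> f"
  have lin2: "linear \<psi>" unfolding \<psi>_def by (rule linear_compose[OF lin lin])
  have sim2: "norm (\<psi> x - \<psi> y) = c\<^sup>2 * norm (x - y)" for x y
    by (simp add: \<psi>_def sim power2_eq_square)
  have c2: "c\<^sup>2 > 1" using c by (simp add: one_less_power)
  have "expanding_similitude \<psi>" unfolding expanding_similitude_def using lin2 sim2 c2 by blast
  moreover have "orientation_preserving \<psi>"
  proof -
    have "inj f" by (rule similitude_inj[of f c]) (use sim c in auto)
    then have "det (matrix f) \<noteq> 0" using det_nz_iff_inj[OF lin] by simp
    moreover have "det (matrix \<psi>) = det (matrix f) * det (matrix f)"
      unfolding \<psi>_def by (simp add: matrix_compose[OF lin lin] det_mul)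
    ultimately show ?thesis
      unfolding orientation_preserving_def by (auto simp: zero_less_mult_iff linorder_neq_iff)
  qed
  moreover have "finite_under \<psi> (derived_voronoi_family T)"
  proof -
    \<comment> \<open>Inflating twice gives radius \<open>c * (c * r - R) - R\<close>, whence the
      loss \<open>c * R + R\<close>.\<close>
    interpret inflated_tiling T \<psi> "c\<^sup>2" "c * R + R"
    proof
      show "agree T (\<psi> x) (\<psi> y) (c\<^sup>2 * r - (c * R + R))" if "agree T x y r" for x y r
        using inflate[OF inflate[OF that]] by (simp add: \<psi>_def power2_eq_square algebra_simps)
    qed (use T assms(1) sim2 c2 R(1) c linear_add[OF lin2] linear_cmul[OF lin2] in auto)
    show ?thesis by (rule finite_under_derived_voronoi_family)
  qed
  ultimately show ?thesis by blast
qed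

theorem theorem3p3:
  fixes T :: "('n::finite, 'l) tile set"
  assumes "is_tiling T" and "FLC T" and "repetitive T" and "nonperiodic T"
  shows "pseudo_self_similar T \<longleftrightarrow>
    (\<exists>\<psi>. expanding_similitude \<psi> \<and> orientation_preserving \<psi> \<and>
         finite_under \<psi> (derived_voronoi_family T))"
proof -
  interpret rep_tiling T by unfold_locales (use assms in auto)
  show ?thesis
    using finite_under_if_pseudo_self_similar pseudo_self_similar_if_finite_under assms(4) by blast
qed

end
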